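(* Let $\mathfrak{X}=(\Omega,\mathcal{C})$ be a symmetric Jordan configuration. If $\mathfrak{X}$ is proper, then $|\mathcal{C}|\geq 5$. Moreover, if $\mathfrak{X}$ is proper and $|\mathcal{C}|=5$, then $\mathfrak{X}$ is homogeneous and the real span $\mathcal{J}:=\mathbb{R}\langle \underline{C}\,:\,C\in\mathcal{C}\rangle\subseteq M_\Omega(\mathbb{R})$, equipped with the Jordan product $A\star B=\frac12(AB+BA)$, is isomorphic as a Jordan algebra to $\mathbb{R}\oplus\mathbb{R}\oplus \mathrm{Sym}_2(\mathbb{R})$, where $\mathrm{Sym}_2(\mathbb{R})$ denotes the real symmetric $2\times 2$ matrices with product $X\star Y=\frac12(XY+YX)$.
   Context: $\Omega$ is a finite set. For $R\subseteq\Omega^2$ and $\alpha\in\Omega$ put $R(\alpha)=\{\beta:(\alpha,\beta)\in R\}$, $R^\top=\{(\beta,\alpha):(\alpha,\beta)\in R\}$, and let $\underline{R}$ be the $\{0,1\}$ adjacency matrix of $R$. A rainbow is a partition $\mathcal{C}$ of $\Omega^2$ such that the diagonal $1_\Omega=\{(\omega,\omega)\}$ is a union of classes and $C^\top\in\mathcal{C}$ for all $C\in\mathcal{C}$; the classes are basic relations and $|\mathcal{C}|$ is the rank. A Jordan configuration is a rainbow such that for all $C,D\in\mathcal{C}$ and all $(\alpha,\beta),(\alpha',\beta')$ lying in the same class of $\mathcal{C}$, $|C(\alpha)\cap D^\top(\beta)|+|D(\alpha)\cap C^\top(\beta)|=|C(\alpha')\cap D^\top(\beta')|+|D(\alpha')\cap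 C^\top(\beta')|$. It is symmetric if every basic relation satisfies $C=C^\top$, and homogeneous if $1_\Omega\in\mathcal{C}$. A coherent algebra is a subspace of $M_\Omega(\mathbb{R})$ containing the identity and all-one matrices and closed under transposition, ordinary matrix product and entrywise (Schur–Hadamard) product; its symmetrization is its subset of symmetric matrices. A Jordan configuration is proper if $\mathbb{R}\langle\underline{C}:C\in\mathcal{C}\rangle$ is not the symmetrization of any coherent algebra. *)

theory Defs
  imports "HOL-Analysis.Analysis" "HOL-Library.Disjoint_Sets"
begin

text \<open>The finite set \<open>\<Omega>\<close> is the universe of a type \<open>'a\<close> of class \<open>finite\<close>, so that
  the matrix space over \<open>\<Omega>\<close> is \<^typ>\<open>real^'a^'a\<close>. In the relational notation of HOL, \<open>R(\<alpha>)\<close> is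
  \<open>R `` {\<alpha>}\<close>, the transpose of \<open>R\<close> is \<open>R\<inverse>\<close>, and the diagonal is \<^const>\<open>Id\<close>.\<close>

definition adjacency_matrix :: "('a::finite) rel \<Rightarrow> real^'a^'a" where
  "adjacency_matrix R = (\<chi> \<alpha> \<beta>. if (\<alpha>, \<beta>) \<in> R then 1 else 0)"

definition rainbow :: "('a::finite) rel set \<Rightarrow> bool" where
  "rainbow \<C> \<longleftrightarrow>
     partition_on UNIV \<C> \<and> (\<exists>\<D>\<subseteq>\<C>. \<Union>\<D> = Id) \<and> (\<forall>C\<in>\<C>. C\<inverse> \<in> \<C>)"

definition jordan_configuration :: "('a::finite) rel set \<Rightarrow> bool" where
  "jordan_configuration \<C> \<longleftrightarrow>
     rainbow \<C> \<and>
     (\<forall>C\<in>\<C>. \<forall>D\<in>\<C>. \<forall>E\<in>\<C>. \<forall>(\<alpha>, \<beta>)\<in>E. \<forall>(\<alpha>', \<beta>')\<in>E.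
        card (C `` {\<alpha>} \<inter> D\<inverse> `` {\<beta>}) + card (D `` {\<alpha>} \<inter> C\<inverse> `` {\<beta>}) =
        card (C `` {\<alpha>'} \<inter> D\<inverse> `` {\<beta>'}) + card (D `` {\<alpha>'} \<inter> C\<inverse> `` {\<beta>'}))"

definition symmetric_configuration :: "('a::finite) rel set \<Rightarrow> bool" where
  "symmetric_configuration \<C> \<longleftrightarrow> (\<forall>C\<in>\<C>. C = C\<inverse>)"

definition homogeneous_configuration :: "('a::finite) rel set \<Rightarrow> bool" where
  "homogeneous_configuration \<C> \<longleftrightarrow> Id \<in> \<C>"

definition coherent_algebra :: "(real^'a^'a) set \<Rightarrow> bool" where
  "coherent_algebra \<A> \<longleftrightarrow>
     subspace \<A> \<and> mat 1 \<in> \<A> \<and> (\<chi> \<alpha> \<beta>. 1) \<in> \<A> \<and>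
     (\<forall>A\<in>\<A>. transpose A \<in> \<A>) \<and>
     (\<forall>A\<in>\<A>. \<forall>B\<in>\<A>. A ** B \<in> \<A>) \<and>
     (\<forall>A\<in>\<A>. \<forall>B\<in>\<A>. (\<chi> \<alpha> \<beta>. A $ \<alpha> $ \<beta> * B $ \<alpha> $ \<beta>) \<in> \<A>)"

definition symmetrization :: "(real^'a^'a) set \<Rightarrow> (real^'a^'a) set" where
  "symmetrization \<A> = {A \<in> \<A>. transpose A = A}"

definition configuration_span :: "('a::finite) rel set \<Rightarrow> (real^'a^'a) set" where
  "configuration_span \<C> = span (adjacency_matrix ` \<C>)"

definition proper_configuration :: "('a::finite) rel set \<Rightarrow> bool" where
  "proper_configuration \<C> \<longleftrightarrow>
     \<not> (\<exists>\<A>. coherent_algebra \<A> \<and> configuration_span \<C> = symmetrization \<A>)"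

definition jordan_product :: "real^'n^'n \<Rightarrow> real^'n^'n \<Rightarrow> real^'n^'n" where
  "jordan_product A B = (1 / 2) *\<^sub>R (A ** B + B ** A)"

text \<open>Real Jordan algebras, given by a carrier subspace \<open>J\<close> of a real vector space and a
  product that only matters on \<open>J\<close>.\<close>

definition jordan_algebra_on :: "('v::real_vector) set \<Rightarrow> ('v \<Rightarrow> 'v \<Rightarrow> 'v) \<Rightarrow> bool" where
  "jordan_algebra_on J p \<longleftrightarrow>
     subspace J \<and>
     (\<forall>x\<in>J. \<forall>y\<in>J. p x y \<in> J) \<and>
     (\<forall>x\<in>J. \<forall>y\<in>J. \<forall>z\<in>J. p (x + y) z = p x z + p y z) \<and>
     (\<forall>r. \<forall>x\<in>J. \<forall>y\<in>J. p (r *\<^sub>R x) y = r *\<^sub>R p x y) \<and>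
     (\<forall>x\<in>J. \<forall>y\<in>J. p x y = p y x) \<and>
     (\<forall>x\<in>J. \<forall>y\<in>J. p (p x y) (p x x) = p x (p y (p x x)))"

definition jordan_algebra_isomorphic ::
  "('v::real_vector) set \<Rightarrow> ('v \<Rightarrow> 'v \<Rightarrow> 'v) \<Rightarrow> ('w::real_vector) set \<Rightarrow> ('w \<Rightarrow> 'w \<Rightarrow> 'w) \<Rightarrow> bool" where
  "jordan_algebra_isomorphic J p K q \<longleftrightarrow>
     jordan_algebra_on J p \<and> jordan_algebra_on K q \<and>
     (\<exists>\<phi>. bij_betw \<phi> J K \<and>
        (\<forall>x\<in>J. \<forall>y\<in>J. \<phi> (x + y) = \<phi> x + \<phi> y) \<and>
        (\<forall>r. \<forall>x\<in>J. \<phi> (r *\<^sub>R x) = r *\<^sub>R \<phi> x) \<and>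
        (\<forall>x\<in>J. \<forall>y\<in>J. \<phi> (p x y) = q (\<phi> x) (\<phi> y)))"

definition Sym2 :: "(real^2^2) set" where
  "Sym2 = {X. transpose X = X}"

definition RR_Sym2 :: "(real \<times> real \<times> (real^2^2)) set" where
  "RR_Sym2 = UNIV \<times> UNIV \<times> Sym2"

fun RR_Sym2_product ::
  "real \<times> real \<times> (real^2^2) \<Rightarrow> real \<times> real \<times> (real^2^2) \<Rightarrow> real \<times> real \<times> (real^2^2)" where
  "RR_Sym2_product (a, b, X) (c, d, Y) = (a * c, b * d, jordan_product X Y)"

end

theory Submission
  imports Defs
begin

text \<open>Let \<open>S\<close> be the span of the configuration and \<open>n = |\<Omega>|\<close>. If \<open>S\<close> is commutative, it is its
  own coherent algebra. In the homogeneous case the all-one matrix \<open>\<one>\<close> is central, so \<open>S\<close> is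
  the sum of \<open>\<real>\<one>\<close> and the corner \<open>{X \<in> S. X\<one> = 0}\<close> with unit \<open>E = I - \<one>/n\<close>, of dimension
  \<open>|\<C>| - 1\<close>.

  For \<open>|\<C>| \<ge> 4\<close> the corner contains an element of degree at least three over \<open>E\<close>: otherwise
  every corner element \<open>X\<close> with \<open>X\<^sup>2 \<in> \<real>E\<close>, \<open>X \<notin> \<real>E\<close> has trace zero, which makes each
  basic graph strongly regular of valency at least \<open>(n - 1)/2\<close>, and three such graphs do not fit
  into the complete graph. In dimension three the corner is then generated by one element, hence
  commutative. In dimension four, unless commutative, it contains three orthogonal idempotents
  with sum \<open>E\<close> and a nonzero element of a mixed Peirce component, which together form a
  frame of \<open>\<real> \<oplus> Sym\<^sub>2(\<real>)\<close>.

  An inhomogeneous configuration of rank at most five has exactly two fibers, joined by a single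
  class, and commutative blocks of rank at most three. Orienting the joining class gives a
  coherent algebra with symmetrization \<open>S\<close>, so the configuration is not proper.\<close>

section \<open>Jordan algebras of symmetric matrices\<close>

lemma matrix_mult_bilinear:
  fixes A B C :: "real^'n^'n"
  shows "(A + B) ** C = A ** C + B ** C" "A ** (B + C) = A ** B + A ** C"
    "(A - B) ** C = A ** C - B ** C" "A ** (B - C) = A ** B - A ** C"
    "(- A) ** B = - (A ** B)" "A ** (- B) = - (A ** B)"
    "(r *\<^sub>R A) ** B = r *\<^sub>R (A ** B)" "A ** (r *\<^sub>R B) = r *\<^sub>R (A ** B)"
  by (simp_all add: vec_eq_iff matrix_matrix_mult_def algebra_simps sum.distrib sum_subtractf
      sum_negf sum_distrib_left)

lemma transpose_linear:
  fixes A B :: "real^'n^'n"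
  shows "transpose (A + B) = transpose A + transpose B"
    "transpose (A - B) = transpose A - transpose B"
    "transpose (- A) = - transpose A"
  by (simp_all add: vec_eq_iff transpose_def)

lemma trace_scaleR: "trace (r *\<^sub>R A) = r * trace (A :: real^'n^'n)"
  by (simp add: trace_def sum_distrib_left)

lemma trace_transpose_mult_self: "trace (transpose A ** A) = A \<bullet> (A :: real^'n^'n)"
  by (simp add: trace_def transpose_def matrix_matrix_mult_def inner_vec_def) (rule sum.swap)

text \<open>The trace of \<open>transpose A ** A\<close> is the squared Frobenius norm of
  \<open>A\<close>; here it is also the trace of \<open>A ** A\<close>, which vanishes.\<close>

lemma symmetric_square_eq_0:
  fixes A :: "real^'n^'n"
  assumes "transpose A = A" "A ** A = 0"
  shows "A = 0"
  using trace_transpose_mult_self[of A] assms by (simp add: trace_def)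

text \<open>The matrices commuting with a fixed one form a subspace, so commutation passes from
  \<open>B\<close> to its span one argument at a time.\<close>

lemma span_commute:
  fixes B :: "(real^'n^'n) set"
  assumes "\<And>x y. x \<in> B \<Longrightarrow> y \<in> B \<Longrightarrow> x ** y = y ** x" "x \<in> span B" "y \<in> span B"
  shows "x ** y = y ** x"
proof -
  have *: "x ** y = y ** x" if "y \<in> B" for y
    using assms(2)
  proof (induction rule: span_induct)
    case base
    show ?case
      by (auto simp: subspace_def matrix_mult_bilinear)
  qed (use assms(1) that in auto)
  show ?thesis
    using assms(3)
  proof (induction rule: span_induct)
    case base
    show ?case
      by (auto simp: subspace_def matrix_mult_bilinear)
  qed (use * in auto)
qed

text \<open>Intermediate value theorem on \<open>{- R..R}\<close>, where \<open>R\<close> is so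
  large that the leading term dominates at both ends.\<close>

lemma cubic_has_real_root: "\<exists>x. x ^ 3 = a * x ^ 2 + b * x + (c :: real)"
proof -
  define f where "f x = x ^ 3 - (a * x ^ 2 + b * x + c)" for x
  define R where "R = 1 + \<bar>a\<bar> + \<bar>b\<bar> + \<bar>c\<bar>"
  have "R \<ge> 1"
    by (simp add: R_def)
  then have R2: "R \<le> R ^ 2" "1 \<le> R ^ 2" "R ^ 3 = R * R ^ 2"
    by (simp_all add: power2_eq_square power3_eq_cube one_le_power mult_ge1_I)
  have bound: "\<bar>a * x ^ 2 + b * x + c\<bar> < R ^ 3" if "\<bar>x\<bar> = R" for x
  proof -
    have "x ^ 2 = R ^ 2"
      using that by (metis power2_abs)
    have "\<bar>a * x ^ 2 + b * x + c\<bar> \<le> \<bar>a * x ^ 2\<bar> + \<bar>b * x\<bar> + \<bar>c\<bar>"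
      by linarith
    also have "\<dots> = \<bar>a\<bar> * R ^ 2 + \<bar>b\<bar> * R + \<bar>c\<bar> * 1"
      using \<open>x ^ 2 = R ^ 2\<close> that by (simp add: abs_mult)
    also have "\<dots> \<le> \<bar>a\<bar> * R ^ 2 + \<bar>b\<bar> * R ^ 2 + \<bar>c\<bar> * R ^ 2"
      by (intro add_mono mult_left_mono R2) auto
    also have "\<dots> = (R - 1) * R ^ 2"
      by (simp add: R_def algebra_simps)
    also have "\<dots> < R ^ 3"
      using R2 \<open>R \<ge> 1\<close> by (simp add: algebra_simps)
    finally show ?thesis .
  qed
  have "f (- R) \<le> 0" "0 \<le> f R"
    using bound[of R] bound[of "- R"] \<open>R \<ge> 1\<close> by (auto simp: f_def power3_eq_cube)
  moreover have "continuous_on {- R..R} f"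
    unfolding f_def by (intro continuous_intros)
  ultimately obtain x where "f x = 0"
    using IVT'[of f "- R" 0 R] \<open>R \<ge> 1\<close> by auto
  then show ?thesis
    by (auto simp: f_def intro!: exI[of _ x])
qed

text \<open>Ordinary matrix products are available although \<open>J\<close> is closed only under
  symmetrized ones. The unit \<open>E\<close> may differ from the identity matrix, because the
  locale is meant for a corner of a larger algebra.\<close>

locale matrix_jordan_algebra =
  fixes J :: "(real^'n^'n) set" and E :: "real^'n^'n"
  assumes subspace_J: "subspace J"
    and unit_mem: "E \<in> J"
    and unit_left: "X \<in> J \<Longrightarrow> E ** X = X"
    and symmetric: "X \<in> J \<Longrightarrow> transpose X = X"
    and jordan: "X \<in> J \<Longrightarrow> Y \<in> J \<Longrightarrow> X ** Y + Y ** X \<in> J"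
begin

lemma unit_right: "X \<in> J \<Longrightarrow> X ** E = X"
  by (metis matrix_transpose_mul symmetric unit_left unit_mem)

lemma J_intros [intro]:
  "0 \<in> J" "X \<in> J \<Longrightarrow> Y \<in> J \<Longrightarrow> X + Y \<in> J" "X \<in> J \<Longrightarrow> Y \<in> J \<Longrightarrow> X - Y \<in> J"
  "X \<in> J \<Longrightarrow> r *\<^sub>R X \<in> J"
  using subspace_J by (auto simp: subspace_0 subspace_add subspace_diff subspace_scale)

lemma commuting_mult: 
  assumes "X \<in> J" "Y \<in> J" "X ** Y = Y ** X"
  shows "X ** Y \<in> J"
proof -
  have "(1/2) *\<^sub>R (X ** Y + Y ** X) \<in> J"
    using assms jordan by blast
  then show ?thesis
    using assms(3) by (simp flip: scaleR_add_left)
qed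

lemma square_mem: "X \<in> J \<Longrightarrow> X ** X \<in> J"
  by (simp add: commuting_mult)

text \<open>With \<open>P = X ** Y + Y ** X\<close>, the sum \<open>P ** X + X ** P\<close> is twice
  \<open>X ** Y ** X\<close> plus \<open>X ** X ** Y + Y ** X ** X\<close>, and everything except
  the triple product is visibly in \<open>J\<close>.\<close>

lemma triple:
  assumes X: "X \<in> J" and Y: "Y \<in> J"
  shows "X ** Y ** X \<in> J"
proof -
  let ?P = "X ** Y + Y ** X" and ?S = "X ** X"
  have "(1/2) *\<^sub>R ((?P ** X + X ** ?P) - (?S ** Y + Y ** ?S)) \<in> J"
    by (intro J_intros jordan square_mem X Y)
  also have "(1/2) *\<^sub>R ((?P ** X + X ** ?P) - (?S ** Y + Y ** ?S)) = X ** Y ** X"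
    by (simp add: matrix_mult_bilinear matrix_mul_assoc flip: scaleR_2)
  finally show ?thesis .
qed

text \<open>Linearization of \<open>X ** Y ** X\<close> in \<open>X\<close>; it puts the symmetrized
  mixed Peirce components into \<open>J\<close>.\<close>

lemma triple_polarized:
  assumes "X \<in> J" "Y \<in> J" "Z \<in> J"
  shows "X ** Y ** Z + Z ** Y ** X \<in> J"
proof -
  have "(X + Z) ** Y ** (X + Z) - X ** Y ** X - Z ** Y ** Z \<in> J"
    by (intro J_intros triple assms)
  also have "(X + Z) ** Y ** (X + Z) - X ** Y ** X - Z ** Y ** Z = X ** Y ** Z + Z ** Y ** X"
    by (simp add: matrix_mult_bilinear algebra_simps)
  finally show ?thesis .
qed

lemma subset_spanI:
  assumes "B \<subseteq> J" "independent B" "dim J \<le> card B"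
  shows "J \<subseteq> span B"
  using assms by (intro card_ge_dim_independent) auto

section \<open>Elements quadratic over the unit and their traces\<close>

lemma square_eq_unit:
  assumes "X \<in> J" "X ** X = c *\<^sub>R E" "X \<noteq> 0"
  shows "c \<noteq> 0"
  using assms symmetric[of X] symmetric_square_eq_0[of X] by auto

text \<open>An element \<open>X\<close> with \<open>X\<^sup>2 = c E\<close> has trace zero because some invertible \<open>V\<close>
  anticommutes with it.\<close>

lemma trace_eq_0:
  assumes quad: "\<And>X. X \<in> J \<Longrightarrow> \<exists>t b. X ** X = t *\<^sub>R X + b *\<^sub>R E"
    and dim: "dim J \<ge> 3" and X: "X \<in> J" and XX: "X ** X = c *\<^sub>R E" and XE: "X \<notin> span {E}"
  shows "trace X = 0"
proof -
  have "\<not> J \<subseteq> span {E, X}"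
  proof
    assume "J \<subseteq> span {E, X}"
    then have "dim J \<le> card {E, X}"
      by (intro dim_le_card) auto
    also have "\<dots> \<le> 2"
      by (simp add: card_insert_if)
    finally show False
      using dim by simp
  qed
  then obtain Y0 where Y0: "Y0 \<in> J" "Y0 \<notin> span {E, X}"
    by auto
  obtain t b where tb: "Y0 ** Y0 = t *\<^sub>R Y0 + b *\<^sub>R E"
    using quad Y0 by blast
  \<comment> \<open>Completing the square removes the linear term, so that \<open>Y ** Y\<close> is
    a multiple of \<open>E\<close>.\<close>
  define Y where "Y = Y0 - (t/2) *\<^sub>R E"
  have Y: "Y \<in> J"
    using Y0 unit_mem by (auto simp: Y_def)
  have E2: "E ** E = E"
    using unit_left unit_mem by auto
  have "Y ** Y = (b + t^2/4) *\<^sub>R E"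
    using tb Y0 by (simp add: Y_def matrix_mult_bilinear unit_left unit_right E2 algebra_simps
        power2_eq_square flip: scaleR_add_left)
  then obtain e where YY: "Y ** Y = e *\<^sub>R E"
    by blast
  have YEX: "Y \<notin> span {E, X}"
  proof
    assume "Y \<in> span {E, X}"
    then have "Y + (t/2) *\<^sub>R E \<in> span {E, X}"
      by (intro span_add span_scale[OF span_base]) auto
    then show False
      using Y0 by (simp add: Y_def)
  qed
  have indep: "\<beta> = 0 \<and> \<alpha> = 0" if eq: "\<alpha> *\<^sub>R X + \<beta> *\<^sub>R Y = \<gamma> *\<^sub>R E" for \<alpha> \<beta> \<gamma>
  proof -
    have "\<beta> = 0"
    proof (rule ccontr)
      assume "\<beta> \<noteq> 0"
      have "\<beta> *\<^sub>R Y = \<gamma> *\<^sub>R E - \<alpha> *\<^sub>R X"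
        using eq by (simp add: algebra_simps)
      then have "Y = (1/\<beta>) *\<^sub>R (\<gamma> *\<^sub>R E - \<alpha> *\<^sub>R X)"
        using \<open>\<beta> \<noteq> 0\<close> by (metis divide_inverse mult_1 real_vector_affinity_eq scaleR_one scaleR_scaleR right_inverse mult.commute)
      also have "\<dots> \<in> span {E, X}"
        by (intro span_scale span_diff span_base) auto
      finally show False
        using YEX by simp
    qed
    moreover have "\<alpha> = 0"
    proof (rule ccontr)
      assume "\<alpha> \<noteq> 0"
      moreover have "\<alpha> *\<^sub>R X = \<gamma> *\<^sub>R E"
        using eq \<open>\<beta> = 0\<close> by simp
      ultimately have "X = (\<gamma>/\<alpha>) *\<^sub>R E"
        by (metis divide_inverse mult.commute right_inverse scaleR_one scaleR_scaleR)
      then show False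
        using XE by (metis rangeI span_singleton)
    qed
    ultimately show ?thesis ..
  qed
  \<comment> \<open>Adding the relations for \<open>X + Y\<close> and \<open>X - Y\<close> cancels
    the Jordan product of \<open>X\<close> and \<open>Y\<close>. Then \<open>indep\<close> gives
    \<open>s + s' = 0\<close> and \<open>s - s' = 0\<close>, so that this Jordan product is a
    multiple of \<open>E\<close>.\<close>
  obtain s g where sg: "(X + Y) ** (X + Y) = s *\<^sub>R (X + Y) + g *\<^sub>R E"
    using quad X Y by blast
  obtain s' g' where sg': "(X - Y) ** (X - Y) = s' *\<^sub>R (X - Y) + g' *\<^sub>R E"
    using quad X Y by blast
  have "X ** Y + Y ** X = s *\<^sub>R X + s *\<^sub>R Y + (g - c - e) *\<^sub>R E"
    using sg XX YY by (simp add: matrix_mult_bilinear algebra_simps)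
  then obtain h where 1: "X ** Y + Y ** X = s *\<^sub>R X + s *\<^sub>R Y + h *\<^sub>R E"
    by blast
  have "- (X ** Y + Y ** X) = s' *\<^sub>R X - s' *\<^sub>R Y + (g' - c - e) *\<^sub>R E"
    using sg' XX YY by (simp add: matrix_mult_bilinear algebra_simps)
  then obtain h' where 2: "- (X ** Y + Y ** X) = s' *\<^sub>R X - s' *\<^sub>R Y + h' *\<^sub>R E"
    by blast
  have "(s + s') *\<^sub>R X + (s - s') *\<^sub>R Y = (- h - h') *\<^sub>R E"
    using arg_cong2[OF 1 2, of "(+)"] by (simp add: algebra_simps)
  from indep[OF this] have "s = 0"
    by auto
  then obtain f where f: "X ** Y + Y ** X = f *\<^sub>R E"
    using 1 by auto
  have "X \<noteq> 0"
    using XE span_zero by metis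
  then have "c \<noteq> 0"
    using square_eq_unit X XX by blast
  \<comment> \<open>A Gram-Schmidt step for the bilinear form given by the Jordan product:
    \<open>V\<close> anticommutes with \<open>X\<close>.\<close>
  define V where "V = Y - (f / (2 * c)) *\<^sub>R X"
  have V: "V \<in> J"
    using X Y by (auto simp: V_def)
  have VV: "V ** V = (e - f\<^sup>2 / (4 * c)) *\<^sub>R E"
  proof -
    have "V ** V = Y ** Y - (f / (2 * c)) *\<^sub>R (X ** Y + Y ** X) + (f / (2 * c))\<^sup>2 *\<^sub>R (X ** X)"
      by (simp add: V_def matrix_mult_bilinear algebra_simps power2_eq_square)
    also have "\<dots> = (e - f / (2 * c) * f + (f / (2 * c))\<^sup>2 * c) *\<^sub>R E"
      unfolding f XX YY by (simp add: algebra_simps)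
    also have "e - f / (2 * c) * f + (f / (2 * c))\<^sup>2 * c = e - f\<^sup>2 / (4 * c)"
      using \<open>c \<noteq> 0\<close> by (simp add: field_simps power2_eq_square)
    finally show ?thesis .
  qed
  have XV: "X ** V = - (V ** X)"
  proof -
    have "X ** V + V ** X = (X ** Y + Y ** X) - (f / c) *\<^sub>R (X ** X)"
      by (simp add: V_def matrix_mult_bilinear algebra_simps flip: scaleR_add_left)
    also have "\<dots> = 0"
      unfolding f XX using \<open>c \<noteq> 0\<close> by simp
    finally show ?thesis
      by (simp add: eq_neg_iff_add_eq_0)
  qed
  have "V \<noteq> 0"
    using YEX span_mul[OF span_base, of X "{E, X}"] by (auto simp: V_def)
  then have g: "e - f\<^sup>2 / (4 * c) \<noteq> 0"
    using square_eq_unit V VV by blast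
  \<comment> \<open>Moving \<open>V\<close> around cyclically and then past \<open>X\<close>
    reverses the sign of this trace; as \<open>V ** V\<close> is a nonzero multiple of
    \<open>E\<close>, it is also a nonzero multiple of \<open>trace X\<close>.\<close>
  have "trace (X ** V ** V) = trace (V ** (X ** V))"
    by (rule trace_mul_sym)
  also have "\<dots> = trace (- ((X ** V) ** V))"
    by (subst (2) XV) (simp add: matrix_mult_bilinear matrix_mul_assoc)
  also have "\<dots> = - trace (X ** V ** V)"
    by (simp add: trace_def sum_negf)
  finally have "trace (X ** V ** V) = 0"
    by simp
  moreover have "X ** V ** V = (e - f\<^sup>2 / (4 * c)) *\<^sub>R X"
    using VV X by (simp add: matrix_mult_bilinear unit_right flip: matrix_mul_assoc)
  ultimately show ?thesis
    using g by (simp add: trace_scaleR)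
qed

text \<open>Completing the square reduces this to \<open>trace_eq_0\<close>, applied to
  \<open>X\<close> minus \<open>t/2\<close> times \<open>E\<close>.\<close>

lemma trace_quadratic:
  assumes quad: "\<And>X. X \<in> J \<Longrightarrow> \<exists>t b. X ** X = t *\<^sub>R X + b *\<^sub>R E"
    and dim: "dim J \<ge> 3" and X: "X \<in> J" and XX: "X ** X = t *\<^sub>R X + b *\<^sub>R E" and XE: "X \<notin> span {E}"
  shows "2 * trace X = t * trace E"
proof -
  let ?Y = "X - (t/2) *\<^sub>R E"
  have Y: "?Y \<in> J"
    using X unit_mem by auto
  have E2: "E ** E = E"
    using unit_left unit_mem by auto
  have "?Y ** ?Y = (b + t^2/4) *\<^sub>R E"
    using XX X by (simp add: matrix_mult_bilinear unit_left unit_right E2 algebra_simps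
        power2_eq_square flip: scaleR_add_left)
  moreover have "?Y \<notin> span {E}"
  proof
    assume "?Y \<in> span {E}"
    then have "?Y + (t/2) *\<^sub>R E \<in> span {E}"
      by (intro span_add span_scale[OF span_base]) auto
    then show False
      using XE by simp
  qed
  ultimately have "trace ?Y = 0"
    using trace_eq_0[OF quad dim Y] by blast
  then show ?thesis
    by (simp add: trace_sub trace_scaleR)
qed


section \<open>Elements of degree at least three over the unit\<close>

lemma commute_if_spanned:
  assumes "J \<subseteq> span B" "\<And>x y. x \<in> B \<Longrightarrow> y \<in> B \<Longrightarrow> x ** y = y ** x" "X \<in> J" "Y \<in> J"
  shows "X ** Y = Y ** X"
  using span_commute[of B X Y] assms by auto

text \<open>Any dependency would make \<open>A\<close> quadratic: it expresses \<open>A ** A\<close>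
  directly, or makes \<open>A\<close> a multiple of \<open>E\<close>, or makes \<open>E\<close>
  zero.\<close>

lemma independent_powers:
  assumes A: "A \<in> J" and nq: "\<And>t b. A ** A \<noteq> t *\<^sub>R A + b *\<^sub>R E"
  shows "independent {E, A, A ** A}" "card {E, A, A ** A} = 3"
proof -
  have "E ** E = E"
    using unit_left unit_mem by auto
  have "E \<noteq> 0"
    using nq[of 0 0] A unit_left[of A] by auto
  have 1: "A \<notin> span {E}"
  proof
    assume "A \<in> span {E}"
    then obtain k where "A = k *\<^sub>R E"
      by (auto simp: span_singleton)
    then have "A ** A = k *\<^sub>R A + 0 *\<^sub>R E"
      by (simp add: matrix_mult_bilinear \<open>E ** E = E\<close>)
    then show False
      using nq by blast
  qed
  have 2: "A ** A \<notin> span {A, E}"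
  proof
    assume "A ** A \<in> span {A, E}"
    then obtain k l where "A ** A - k *\<^sub>R A = l *\<^sub>R E"
      by (auto simp: span_breakdown_eq span_singleton)
    then have "A ** A = k *\<^sub>R A + l *\<^sub>R E"
      by (simp add: algebra_simps)
    then show False
      using nq by blast
  qed
  have "independent {A ** A, A, E}"
    using 1 2 \<open>E \<noteq> 0\<close> by (simp add: independent_insert)
  moreover have eq: "{A ** A, A, E} = {E, A, A ** A}"
    by auto
  ultimately show "independent {E, A, A ** A}"
    by simp
  have "card {A ** A, A, E} = 3"
    using 1 2 span_base by (auto simp: card_insert_if)
  then show "card {E, A, A ** A} = 3"
    by (simp add: eq)
qed

text \<open>By dimension \<open>J\<close> is spanned by \<open>E\<close>, \<open>A\<close> and
  \<open>A ** A\<close>, the powers of a single element.\<close>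

lemma commute_dim_3:
  assumes "A \<in> J" "\<And>t b. A ** A \<noteq> t *\<^sub>R A + b *\<^sub>R E" "dim J \<le> 3" "X \<in> J" "Y \<in> J"
  shows "X ** Y = Y ** X"
proof (rule commute_if_spanned)
  show "J \<subseteq> span {E, A, A ** A}"
    using independent_powers[OF assms(1,2)] assms by (intro subset_spanI) (auto intro: unit_mem square_mem)
qed (use assms in \<open>auto simp: unit_left unit_right unit_mem square_mem matrix_mul_assoc\<close>)

text \<open>If \<open>A ** A ** A\<close> is independent of the lower powers, the four powers span
  \<open>J\<close> by dimension, and they commute. Otherwise the dependency is the cubic
  equation.\<close>

lemma commute_or_cubic:
  assumes A: "A \<in> J" and nq: "\<And>t b. A ** A \<noteq> t *\<^sub>R A + b *\<^sub>R E" and "dim J \<le> 4"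
  shows "(\<forall>X\<in>J. \<forall>Y\<in>J. X ** Y = Y ** X) \<or>
    (\<exists>a b c. A ** A ** A = a *\<^sub>R (A ** A) + b *\<^sub>R A + c *\<^sub>R E)"
proof (cases "A ** A ** A \<in> span {E, A, A ** A}")
  case True
  then have "A ** A ** A \<in> span {A ** A, A, E}"
    by (simp add: insert_commute)
  then obtain a b c where "A ** A ** A - a *\<^sub>R (A ** A) - b *\<^sub>R A = c *\<^sub>R E"
    by (auto simp: span_breakdown_eq span_singleton)
  then have "A ** A ** A = a *\<^sub>R (A ** A) + b *\<^sub>R A + c *\<^sub>R E"
    by (simp add: algebra_simps)
  then show ?thesis
    by blast
next
  case False
  let ?B = "insert (A ** A ** A) {E, A, A ** A}"
  note indep = independent_powers[OF A nq]
  have A3: "A ** A ** A \<in> J"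
    using A triple by blast
  have "?B \<subseteq> J"
    using A A3 unit_mem square_mem by auto
  moreover have "independent ?B"
    using False indep by (subst independent_insert) auto
  moreover have "card ?B = 4"
    using False indep span_base[of "A ** A ** A" "{E, A, A ** A}"] by (subst card_insert_disjoint) auto
  ultimately have "J \<subseteq> span ?B"
    using \<open>dim J \<le> 4\<close> by (intro subset_spanI) simp_all
  moreover have "u ** v = v ** u" if "u \<in> ?B" "v \<in> ?B" for u v
    using that A A3 by (auto simp: unit_left unit_right unit_mem square_mem matrix_mul_assoc)
  ultimately have "X ** Y = Y ** X" if "X \<in> J" "Y \<in> J" for X Y
    using that by (rule commute_if_spanned[of ?B])
  then show ?thesis
    by blast
qed

text \<open>One root \<open>x\<close> is real for any cubic. The quadratic cofactor splits because
  \<open>A\<close> is symmetric: a negative discriminant contradicts positivity of the Frobenius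
  norm.\<close>

lemma real_roots:
  assumes A: "A \<in> J" and nq: "\<And>t b. A ** A \<noteq> t *\<^sub>R A + b *\<^sub>R E"
    and cubic: "A ** A ** A = a *\<^sub>R (A ** A) + b *\<^sub>R A + c *\<^sub>R E"
  obtains x y z where "(A - x *\<^sub>R E) ** (A - y *\<^sub>R E) ** (A - z *\<^sub>R E) = 0"
proof -
  obtain x where x: "x ^ 3 = a * x ^ 2 + b * x + c"
    using cubic_has_real_root by blast
  \<comment> \<open>Division by \<open>T - x\<close>: the cubic has cofactor
    \<open>T^2 + p T + q\<close>, and \<open>N\<close> completes the square in it.\<close>
  define p where "p = x - a"
  define q where "q = x * p - b"
  define L where "L = A - x *\<^sub>R E"
  define N where "N = A + (p/2) *\<^sub>R E"
  have E2: "E ** E = E"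
    using unit_left unit_mem by auto
  note E_simps = unit_left[OF A] unit_right[OF A] unit_left[OF square_mem[OF A]]
    unit_right[OF square_mem[OF A]] E2
  have L: "L \<in> J" and N: "N \<in> J"
    using A unit_mem by (auto simp: L_def N_def)
  have c: "c = x * q"
    using x by (simp add: p_def q_def power2_eq_square power3_eq_cube algebra_simps)
  have quot: "L ** (A ** A + p *\<^sub>R A + q *\<^sub>R E) = 0"
    using cubic unfolding c
    by (simp add: L_def matrix_mult_bilinear matrix_mul_assoc E_simps p_def q_def algebra_simps)
  have NN: "N ** N = A ** A + p *\<^sub>R A + (p\<^sup>2/4) *\<^sub>R E"
  proof -
    define h where "h = p/2"
    have p: "p = h + h"
      by (simp add: h_def)
    have "p\<^sup>2/4 = h * h"
      by (simp add: h_def power2_eq_square)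
    moreover have "N = A + h *\<^sub>R E"
      by (simp add: N_def h_def)
    ultimately show ?thesis
      unfolding p by (simp only: matrix_mult_bilinear E_simps scaleR_add_left scaleR_add_right
          scaleR_scaleR add_ac)
  qed
  have NL: "N ** L = L ** N"
    by (simp add: N_def L_def matrix_mult_bilinear E_simps algebra_simps)
  have "p\<^sup>2/4 - q \<ge> 0"
  proof (rule ccontr)
    assume neg: "\<not> p\<^sup>2/4 - q \<ge> 0"
    have "A ** A + p *\<^sub>R A + q *\<^sub>R E = N ** N + (q - p\<^sup>2/4) *\<^sub>R E"
      by (simp add: NN algebra_simps)
    then have "L ** (N ** N) + (q - p\<^sup>2/4) *\<^sub>R L = 0"
      using quot unit_right[OF L] by (simp add: matrix_mult_bilinear)
    \<comment> \<open>One more factor \<open>L\<close> and the trace turn the relation into the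
      squared norm of \<open>N ** L\<close> plus a positive multiple of that of \<open>L\<close>.
      Hence \<open>L = 0\<close>, and \<open>A\<close> is a multiple of \<open>E\<close>.\<close>
    then have "(L ** (N ** N) + (q - p\<^sup>2/4) *\<^sub>R L) ** L = 0"
      by simp
    then have "(L ** N) ** (N ** L) + (q - p\<^sup>2/4) *\<^sub>R (L ** L) = 0"
      by (simp add: matrix_mult_bilinear matrix_mul_assoc)
    moreover have "L ** N = transpose (N ** L)" "transpose L = L"
      using L N symmetric by (simp_all add: matrix_transpose_mul)
    ultimately have "trace (transpose (N ** L) ** (N ** L)) + (q - p\<^sup>2/4) * trace (transpose L ** L) = 0"
      by (metis mat_0 trace_0 trace_add trace_scaleR)
    then have "(N ** L) \<bullet> (N ** L) + (q - p\<^sup>2/4) * (L \<bullet> L) = 0"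
      by (simp only: trace_transpose_mult_self)
    moreover have "(N ** L) \<bullet> (N ** L) \<ge> 0" "(q - p\<^sup>2/4) * (L \<bullet> L) \<ge> 0"
      using neg by auto
    ultimately have "(q - p\<^sup>2/4) * (L \<bullet> L) = 0"
      by linarith
    then have "A = x *\<^sub>R E"
      using neg by (auto simp: L_def)
    then have "A ** A = x *\<^sub>R A + 0 *\<^sub>R E"
      using E2 by (simp add: matrix_mult_bilinear)
    then show False
      using nq by blast
  qed
  then obtain d where d: "d\<^sup>2 = p\<^sup>2/4 - q"
    by (metis real_sqrt_pow2)
  have "(A - (- p/2 + d) *\<^sub>R E) ** (A - (- p/2 - d) *\<^sub>R E) = (N - d *\<^sub>R E) ** (N + d *\<^sub>R E)"
    by (simp add: N_def algebra_simps)
  also have "\<dots> = N ** N - d\<^sup>2 *\<^sub>R E"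
    using unit_left[OF N] unit_right[OF N] E2
    by (simp add: matrix_mult_bilinear power2_eq_square algebra_simps)
  also have "\<dots> = A ** A + p *\<^sub>R A + q *\<^sub>R E"
    by (simp add: NN d algebra_simps)
  finally have "L ** ((A - (- p/2 + d) *\<^sub>R E) ** (A - (- p/2 - d) *\<^sub>R E)) = 0"
    using quot by simp
  then show ?thesis
    using that[of x "- p/2 + d" "- p/2 - d"] by (simp add: L_def matrix_mul_assoc)
qed

text \<open>Lagrange interpolation at the three roots, which are distinct since a repeated root
  would give a nonzero symmetric matrix with square zero.\<close>

lemma orthogonal_idempotents:
  assumes A: "A \<in> J" and nq: "\<And>t b. A ** A \<noteq> t *\<^sub>R A + b *\<^sub>R E"
    and zero: "(A - x *\<^sub>R E) ** (A - y *\<^sub>R E) ** (A - z *\<^sub>R E) = 0"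
  obtains e1 e2 e3 where "e1 \<in> J" "e2 \<in> J" "e3 \<in> J" "e1 \<noteq> 0" "e2 \<noteq> 0" "e3 \<noteq> 0"
    "e1 ** e1 = e1" "e2 ** e2 = e2" "e3 ** e3 = e3"
    "e1 ** e2 = 0" "e1 ** e3 = 0" "e2 ** e3 = 0" "e1 + e2 + e3 = E"
proof -
  define F where "F u = A - u *\<^sub>R E" for u
  have E2: "E ** E = E"
    using unit_left unit_mem by auto
  note E_simps = unit_left[OF A] unit_right[OF A] unit_left[OF square_mem[OF A]]
    unit_right[OF square_mem[OF A]] E2
  have F: "F u \<in> J" for u
    using A unit_mem by (auto simp: F_def)
  have comm: "F u ** F v = F v ** F u" for u v
    by (simp add: F_def matrix_mult_bilinear E_simps algebra_simps)
  have comm3: "X ** F u ** F v = X ** F v ** F u" for X u v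
    by (metis comm matrix_mul_assoc)
  have FF: "F u ** F v \<in> J" for u v
    using commuting_mult F comm by blast
  have FF_ne: "F u ** F v \<noteq> 0" for u v
  proof
    assume "F u ** F v = 0"
    then have "A ** A = (u + v) *\<^sub>R A + (- u * v) *\<^sub>R E"
      by (simp add: F_def matrix_mult_bilinear E_simps algebra_simps)
    then show False
      using nq by blast
  qed
  have zero': "F x ** F y ** F z = 0" 
    using zero by (simp add: F_def)
  have shift: "F u = F v + (v - u) *\<^sub>R E" for u v
    by (simp add: F_def algebra_simps)
  have distinct: "u \<noteq> v" if "F u ** F v ** F w = 0" for u v w
  proof
    assume "u = v"
    then have "(F v ** F w) ** (F v ** F w) = 0"
      using that by (metis comm matrix_mul_assoc times0_left)
    then show False
      using symmetric_square_eq_0 FF symmetric FF_ne by blast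
  qed
  have "x \<noteq> y" "x \<noteq> z" "y \<noteq> z"
    by (intro distinct[of x y z] distinct[of x z y] distinct[of y z x];
        simp add: comm comm3 zero')+
  \<comment> \<open>The Lagrange basis polynomial at \<open>u\<close>, evaluated at
    \<open>A\<close>.\<close>
  define G where "G u v w = (1 / ((u - v) * (u - w))) *\<^sub>R (F v ** F w)" for u v w
  have idem: "G u v w ** G u v w = G u v w" if "F u ** F v ** F w = 0" "u \<noteq> v" "u \<noteq> w" for u v w
  proof -
    have z: "F u ** (F v ** F w) = 0"
      using that by (simp add: matrix_mul_assoc)
    \<comment> \<open>As \<open>F u\<close> annihilates \<open>F v ** F w\<close>, the matrix
      \<open>A\<close> acts on this product as the scalar \<open>u\<close>.\<close>
    have 1: "F t ** (F v ** F w) = (u - t) *\<^sub>R (F v ** F w)" for t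
      using z unit_left[OF FF] by (subst shift[of t u]) (simp add: matrix_mult_bilinear)
    have "(F v ** F w) ** (F v ** F w) = ((u - v) * (u - w)) *\<^sub>R (F v ** F w)"
      by (simp add: 1 matrix_mult_bilinear flip: matrix_mul_assoc)
    then show ?thesis
      using that by (simp add: G_def matrix_mult_bilinear)
  qed
  let ?e1 = "G x y z" and ?e2 = "G y x z"
  \<comment> \<open>Taking a complement makes the sum of the three immediate. It is nonzero because
    \<open>F x ** F y\<close> annihilates the other two, so its product with \<open>?e3\<close> is
    \<open>F x ** F y\<close> itself.\<close>
  let ?e3 = "E - ?e1 - ?e2"
  have e: "?e1 \<in> J" "?e2 \<in> J"
    using FF by (auto simp: G_def)
  then have e3: "?e3 \<in> J"
    using unit_mem by blast
  have "F y ** F x ** F z = 0"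
    using zero' comm by metis
  then have i1: "?e1 ** ?e1 = ?e1" and i2: "?e2 ** ?e2 = ?e2"
    using idem zero' \<open>x \<noteq> y\<close> \<open>x \<noteq> z\<close> \<open>y \<noteq> z\<close> by metis+
  have "F x ** F y ** F y ** F z = 0"
    using comm3[of "F x ** F y" y z] zero' by simp
  moreover have "F x ** F x ** F y ** F z = 0"
    using arg_cong[OF zero', of "\<lambda>X. F x ** X"] by (simp add: matrix_mul_assoc)
  ultimately have "(F y ** F z) ** (F x ** F z) = 0" "(F x ** F z) ** (F y ** F z) = 0"
    "(F x ** F y) ** (F y ** F z) = 0" "(F x ** F y) ** (F x ** F z) = 0"
    by (simp_all add: matrix_mul_assoc comm comm3 zero')
  then have o: "?e1 ** ?e2 = 0" "?e2 ** ?e1 = 0" "(F x ** F y) ** ?e1 = 0" "(F x ** F y) ** ?e2 = 0"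
    by (simp_all add: G_def matrix_mult_bilinear)
  have ne: "?e1 \<noteq> 0" "?e2 \<noteq> 0"
    using FF_ne \<open>x \<noteq> y\<close> \<open>x \<noteq> z\<close> \<open>y \<noteq> z\<close> by (auto simp: G_def)
  have "(F x ** F y) ** ?e3 = F x ** F y"
    using o unit_right[OF FF] by (simp add: matrix_mult_bilinear)
  then have "?e3 \<noteq> 0"
    using FF_ne by (metis times0_right)
  then show ?thesis
    using e e3 ne i1 i2 o unit_left[OF e(1)] unit_left[OF e(2)] unit_right[OF e(1)] unit_right[OF e(2)] E2
    by (intro that[of ?e1 ?e2 ?e3]) (simp_all add: matrix_mult_bilinear)
qed

end

section \<open>Peirce decomposition for three orthogonal idempotents\<close>

lemma independent_orthogonal_idempotents:
  fixes e1 e2 e3 :: "real^'n^'n"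
  assumes "e1 \<noteq> 0" "e2 \<noteq> 0" "e3 \<noteq> 0" "e1 ** e1 = e1" "e2 ** e2 = e2" "e3 ** e3 = e3"
    "e1 ** e2 = 0" "e1 ** e3 = 0" "e2 ** e3 = 0"
  shows "independent {e1, e2, e3}" "card {e1, e2, e3} = 3"
proof -
  have 1: "e2 \<notin> span {e3}" "e1 \<notin> span {e2, e3}"
  proof -
    show "e2 \<notin> span {e3}"
      using assms by (auto simp: span_singleton matrix_mult_bilinear)
    show "e1 \<notin> span {e2, e3}"
    proof
      assume "e1 \<in> span {e2, e3}"
      then obtain k l where "e1 - k *\<^sub>R e2 = l *\<^sub>R e3"
        by (auto simp: span_breakdown_eq span_singleton)
      then have "e1 ** (e1 - k *\<^sub>R e2) = e1 ** (l *\<^sub>R e3)"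
        by simp
      then show False
        using assms by (simp add: matrix_mult_bilinear)
    qed
  qed
  then show "independent {e1, e2, e3}"
    using assms by (simp add: independent_insert)
  show "card {e1, e2, e3} = 3"
    using 1 span_base by (auto simp: card_insert_if)
qed

context matrix_jordan_algebra
begin

text \<open>Inserting \<open>E = e1 + e2 + e3\<close> reduces both \<open>u ** B\<close> and
  \<open>B ** u\<close> to \<open>u ** B ** u\<close>, so the idempotents commute with all of
  \<open>J\<close>. By dimension at most one further element is needed to span
  \<open>J\<close>.\<close>

lemma commute_if_no_mixed_component:
  assumes e: "e1 \<in> J" "e2 \<in> J" "e3 \<in> J" "e1 \<noteq> 0" "e2 \<noteq> 0" "e3 \<noteq> 0"
    "e1 ** e1 = e1" "e2 ** e2 = e2" "e3 ** e3 = e3"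
    "e1 ** e2 = 0" "e1 ** e3 = 0" "e2 ** e3 = 0" "e1 + e2 + e3 = E"
    and dim: "dim J \<le> 4"
    and mixed: "\<And>B. B \<in> J \<Longrightarrow> e1 ** B ** e2 = 0 \<and> e1 ** B ** e3 = 0 \<and> e2 ** B ** e3 = 0"
    and XY: "X \<in> J" "Y \<in> J"
  shows "X ** Y = Y ** X"
proof -
  have mixed': "e2 ** B ** e1 = 0 \<and> e3 ** B ** e1 = 0 \<and> e3 ** B ** e2 = 0" if B: "B \<in> J" for B
  proof -
    have "transpose (e1 ** B ** e2) = e2 ** B ** e1" "transpose (e1 ** B ** e3) = e3 ** B ** e1"
      "transpose (e2 ** B ** e3) = e3 ** B ** e2"
      using e B symmetric by (simp_all add: matrix_transpose_mul matrix_mul_assoc)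
    then show ?thesis
      using mixed[OF B] by (metis transpose_mat mat_0)
  qed
  have comm: "u ** B = B ** u" if B: "B \<in> J" and u: "u \<in> {e1, e2, e3}" for u B
  proof -
    have "u ** B = u ** B ** (e1 + e2 + e3)" "B ** u = (e1 + e2 + e3) ** B ** u"
      using B e(13) unit_left[of B] unit_right[of B] by (simp_all flip: matrix_mul_assoc)
    then show ?thesis
      using mixed[OF B] mixed'[OF B] u by (auto simp: matrix_mult_bilinear)
  qed
  note ind = independent_orthogonal_idempotents[OF e(4-12)]
  obtain B where B: "B \<in> J" "J \<subseteq> span {B, e1, e2, e3}"
  proof (cases "J \<subseteq> span {e1, e2, e3}")
    case True
    then show ?thesis
      using that[of e1] e by simp
  next
    case False
    then obtain B where B: "B \<in> J" "B \<notin> span {e1, e2, e3}"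
      by auto
    then have "independent (insert B {e1, e2, e3})"
      using ind by (subst independent_insert) auto
    moreover have "card (insert B {e1, e2, e3}) = 4"
      using ind B span_base[of B "{e1, e2, e3}"] by (subst card_insert_disjoint) auto
    ultimately have "J \<subseteq> span {B, e1, e2, e3}"
      using e B dim by (intro subset_spanI) auto
    then show ?thesis
      using that B by blast
  qed
  have "u ** v = v ** u" if "u \<in> {B, e1, e2, e3}" "v \<in> {B, e1, e2, e3}" for u v
    using that comm B(1) e(1-3) by auto
  with B(2) show ?thesis
    using XY by (rule commute_if_spanned)
qed

text \<open>A multiple of the component of \<open>B\<close> in the Peirce space between
  \<open>e1\<close> and \<open>e2\<close> works. By dimension it spans \<open>J\<close> together
  with the idempotents, and expanding its square in this basis leaves only a positive multiple of
  \<open>e1 + e2\<close>.\<close>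

lemma Sym2_frame:
  assumes e: "e1 \<in> J" "e2 \<in> J" "e3 \<in> J" "e1 \<noteq> 0" "e2 \<noteq> 0" "e3 \<noteq> 0"
    "e1 ** e1 = e1" "e2 ** e2 = e2" "e3 ** e3 = e3"
    "e1 ** e2 = 0" "e1 ** e3 = 0" "e2 ** e3 = 0"
    and dim: "dim J \<le> 4"
    and B: "B \<in> J" and mixed: "e1 ** B ** e2 \<noteq> 0"
  obtains w where "w \<in> J" "w \<noteq> 0" "e1 ** w = w ** e2" "e2 ** w = w ** e1" "e3 ** w = 0" "w ** e3 = 0"
    "w ** e1 + w ** e2 = w" "w ** w = e1 + e2" "J \<subseteq> span {w, e1, e2, e3}"
proof -
  define w where "w = e1 ** B ** e2 + e2 ** B ** e1"
  have w: "w \<in> J"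
    using e B triple_polarized by (simp add: w_def)
  have rev: "e2 ** e1 = 0" "e3 ** e1 = 0" "e3 ** e2 = 0"
    using e symmetric by (metis matrix_transpose_mul mat_0 transpose_mat)+
  have assoc_simps: "X ** e1 ** e1 = X ** e1" "X ** e2 ** e2 = X ** e2" "X ** e1 ** e2 = 0"
    "X ** e1 ** e3 = 0" "X ** e2 ** e3 = 0" "X ** e2 ** e1 = 0" for X
    using e rev by (simp_all flip: matrix_mul_assoc)
  note simps = matrix_mult_bilinear matrix_mul_assoc assoc_simps e(7-12) rev
  have r: "e1 ** w = w ** e2" "e2 ** w = w ** e1" "e3 ** w = 0" "w ** e3 = 0"
    "w ** e1 + w ** e2 = w"
    by (simp_all add: w_def simps)
  have we2: "w ** e2 \<noteq> 0"
    using mixed by (simp add: w_def simps)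
  then have we1: "w ** e1 \<noteq> 0"
    using r(1) w e symmetric by (metis matrix_transpose_mul mat_0 transpose_mat)
  have "w \<noteq> 0"
    using we2 by auto
  note ind = independent_orthogonal_idempotents[OF e(4-12)]
  \<comment> \<open>Combinations of the idempotents have no mixed component, while that of
    \<open>w\<close> is \<open>w ** e2\<close>.\<close>
  have "w \<notin> span {e1, e2, e3}"
  proof
    assume "w \<in> span {e1, e2, e3}"
    then obtain k l m where "w - k *\<^sub>R e1 - l *\<^sub>R e2 = m *\<^sub>R e3"
      by (auto simp: span_breakdown_eq span_singleton)
    then have "w = k *\<^sub>R e1 + l *\<^sub>R e2 + m *\<^sub>R e3"
      by (simp add: algebra_simps)
    then have "e1 ** w ** e2 = 0"
      by (simp add: simps)
    then show False
      using we2 by (simp add: r simps)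
  qed
  then have "independent (insert w {e1, e2, e3})" "card (insert w {e1, e2, e3}) = 4"
    using ind span_base[of w "{e1, e2, e3}"]
    by (simp add: independent_insert, subst card_insert_disjoint) auto
  then have span: "J \<subseteq> span {w, e1, e2, e3}"
    using e w dim by (intro subset_spanI) auto
  then have "w ** w \<in> span {w, e1, e2, e3}"
    using w square_mem by auto
  then obtain d \<alpha> \<beta> \<gamma> where "w ** w - d *\<^sub>R w - \<alpha> *\<^sub>R e1 - \<beta> *\<^sub>R e2 = \<gamma> *\<^sub>R e3"
    by (auto simp: span_breakdown_eq span_singleton)
  then have ww: "w ** w = d *\<^sub>R w + \<alpha> *\<^sub>R e1 + \<beta> *\<^sub>R e2 + \<gamma> *\<^sub>R e3"
    by (simp add: algebra_simps)
  \<comment> \<open>Three tests determine the coefficients: \<open>w ** e3 = 0\<close> kills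
    \<open>\<gamma>\<close>, the vanishing of \<open>e1 ** (w ** w) ** e2\<close> kills
    \<open>d\<close>, and associativity of the cube of \<open>w\<close> forces
    \<open>\<alpha> = \<beta>\<close>.\<close>
  have "w ** (w ** e3) = \<gamma> *\<^sub>R e3"
    unfolding matrix_mul_assoc ww by (simp add: simps r)
  then have "\<gamma> = 0"
    using r e by simp
  have "e1 ** (w ** w) ** e2 = 0"
    by (simp add: matrix_mul_assoc r) (metis assoc_simps(3) matrix_mul_assoc r(2))
  then have "d *\<^sub>R (w ** e2) = 0"
    unfolding ww by (simp add: simps r)
  then have "d = 0"
    using we2 by simp
  have ww': "w ** w = \<alpha> *\<^sub>R e1 + \<beta> *\<^sub>R e2"
    using ww \<open>d = 0\<close> \<open>\<gamma> = 0\<close> by simp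
  have "w ** (w ** w) = (w ** w) ** w"
    by (simp add: matrix_mul_assoc)
  then have "\<alpha> *\<^sub>R (w ** e1) + \<beta> *\<^sub>R (w ** e2) = \<alpha> *\<^sub>R (w ** e2) + \<beta> *\<^sub>R (w ** e1)"
    unfolding ww' by (simp add: matrix_mult_bilinear r)
  then have "(\<alpha> *\<^sub>R (w ** e1) + \<beta> *\<^sub>R (w ** e2)) ** e1 = (\<alpha> *\<^sub>R (w ** e2) + \<beta> *\<^sub>R (w ** e1)) ** e1"
    by simp
  then have "\<alpha> *\<^sub>R (w ** e1) = \<beta> *\<^sub>R (w ** e1)"
    by (simp add: simps)
  then have "\<alpha> = \<beta>"
    using we1 by simp
  then have ww'': "w ** w = \<alpha> *\<^sub>R (e1 + e2)"
    using ww' by (simp add: scaleR_add_right)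
  \<comment> \<open>Traces turn the formula for \<open>w ** w\<close> into a comparison of two
    squared norms; the square root of \<alpha> then normalizes \<open>w\<close>.\<close>
  have "\<alpha> > 0"
  proof -
    have "(e1 + e2) ** (e1 + e2) = e1 + e2"
      by (simp add: simps)
    then have "trace (e1 + e2) = (e1 + e2) \<bullet> (e1 + e2)"
      using trace_transpose_mult_self[of "e1 + e2"] e symmetric by (simp add: transpose_linear)
    moreover have "trace (w ** w) = w \<bullet> w"
      using trace_transpose_mult_self[of w] w symmetric by simp
    ultimately have "\<alpha> * ((e1 + e2) \<bullet> (e1 + e2)) = w \<bullet> w"
      using ww'' by (simp add: trace_scaleR)
    moreover have "w \<bullet> w > 0" "(e1 + e2) \<bullet> (e1 + e2) \<ge> 0"
      using \<open>w \<noteq> 0\<close> by (auto simp only: inner_gt_zero_iff inner_ge_zero)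
    ultimately show ?thesis
      by (metis zero_less_mult_pos2 less_eq_real_def mult_zero_right less_irrefl)
  qed
  define w' where "w' = (1 / sqrt \<alpha>) *\<^sub>R w"
  have "w' \<in> J" "w' \<noteq> 0"
    using w \<open>w \<noteq> 0\<close> \<open>\<alpha> > 0\<close> by (auto simp: w'_def)
  moreover have "w' ** w' = e1 + e2"
    using ww'' \<open>\<alpha> > 0\<close> by (simp add: w'_def matrix_mult_bilinear)
  moreover have "J \<subseteq> span {w', e1, e2, e3}"
  proof -
    have "w = sqrt \<alpha> *\<^sub>R w'"
      using \<open>\<alpha> > 0\<close> by (simp add: w'_def)
    then have "w \<in> span {w', e1, e2, e3}"
      by (simp add: span_scale span_base)
    then have "span {w, e1, e2, e3} \<subseteq> span {w', e1, e2, e3}"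
      by (intro span_minimal) (auto simp: span_base)
    then show ?thesis
      using span by blast
  qed
  moreover have "w' ** e1 + w' ** e2 = w'"
    by (simp add: w'_def matrix_mult_bilinear r(5) flip: scaleR_add_right)
  ultimately show ?thesis
    using r by (intro that[of w']) (simp_all add: w'_def matrix_mult_bilinear)
qed

text \<open>Noncommutativity leaves the cubic alternative and forces a nonzero mixed component; the
  three cases differ by a renumbering of the idempotents.\<close>

lemma commute_or_Sym2_frame:
  assumes A: "A \<in> J" "\<And>t b. A ** A \<noteq> t *\<^sub>R A + b *\<^sub>R E" and dim: "dim J \<le> 4"
    and nc: "X \<in> J" "Y \<in> J" "X ** Y \<noteq> Y ** X"
  obtains e1 e2 e3 w where "e1 \<in> J" "e2 \<in> J" "e3 \<in> J" "w \<in> J"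
    "e1 \<noteq> 0" "e2 \<noteq> 0" "e3 \<noteq> 0" "w \<noteq> 0"
    "e1 ** e1 = e1" "e2 ** e2 = e2" "e3 ** e3 = e3"
    "e1 ** e2 = 0" "e1 ** e3 = 0" "e2 ** e3 = 0"
    "e1 ** w = w ** e2" "e2 ** w = w ** e1" "e3 ** w = 0" "w ** e3 = 0"
    "w ** e1 + w ** e2 = w" "w ** w = e1 + e2" "J \<subseteq> span {w, e1, e2, e3}"
proof -
  obtain a b c where "A ** A ** A = a *\<^sub>R (A ** A) + b *\<^sub>R A + c *\<^sub>R E"
    using commute_or_cubic[OF A dim] nc by blast
  then obtain x y z where "(A - x *\<^sub>R E) ** (A - y *\<^sub>R E) ** (A - z *\<^sub>R E) = 0"
    using real_roots[OF A] by blast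
  then obtain e1 e2 e3 where e: "e1 \<in> J" "e2 \<in> J" "e3 \<in> J" "e1 \<noteq> 0" "e2 \<noteq> 0" "e3 \<noteq> 0"
    "e1 ** e1 = e1" "e2 ** e2 = e2" "e3 ** e3 = e3"
    "e1 ** e2 = 0" "e1 ** e3 = 0" "e2 ** e3 = 0" "e1 + e2 + e3 = E"
    using orthogonal_idempotents[OF A] by metis
  have rev: "e2 ** e1 = 0" "e3 ** e1 = 0" "e3 ** e2 = 0"
    using e symmetric by (metis matrix_transpose_mul mat_0 transpose_mat)+
  obtain B where B: "B \<in> J" and "e1 ** B ** e2 \<noteq> 0 \<or> e1 ** B ** e3 \<noteq> 0 \<or> e2 ** B ** e3 \<noteq> 0"
    using commute_if_no_mixed_component[OF e dim] nc by blast
  then consider "e1 ** B ** e2 \<noteq> 0" | "e1 ** B ** e3 \<noteq> 0" | "e2 ** B ** e3 \<noteq> 0"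
    by blast
  then show ?thesis
  proof cases
    case 1
    show ?thesis
      by (rule Sym2_frame[of e1 e2 e3 B]) (use e rev dim B 1 that[of e1 e2 e3] in auto)
  next
    case 2
    show ?thesis
      by (rule Sym2_frame[of e1 e3 e2 B]) (use e rev dim B 2 that[of e1 e3 e2] in auto)
  next
    case 3
    show ?thesis
      by (rule Sym2_frame[of e2 e3 e1 B]) (use e rev dim B 3 that[of e2 e3 e1] in auto)
  qed
qed

end

section \<open>The algebra \<open>\<real> \<oplus> \<real> \<oplus> Sym\<^sub>2(\<real>)\<close>\<close>

lemma jordan_algebra_on_jordan_product:
  fixes J :: "(real^'n^'n) set"
  assumes "subspace J" "\<And>X Y. X \<in> J \<Longrightarrow> Y \<in> J \<Longrightarrow> X ** Y + Y ** X \<in> J"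
  shows "jordan_algebra_on J jordan_product"
proof -
  have "jordan_product (X + Y) Z = jordan_product X Z + jordan_product Y Z"
    "jordan_product (r *\<^sub>R X) Y = r *\<^sub>R jordan_product X Y"
    "jordan_product X Y = jordan_product Y X" for X Y Z :: "real^'n^'n" and r
    by (simp_all only: jordan_product_def matrix_mult_bilinear scaleR_add_right scaleR_scaleR
        add_ac mult_ac)
  moreover have "jordan_product (jordan_product X Y) (jordan_product X X) =
      jordan_product X (jordan_product Y (jordan_product X X))" for X Y :: "real^'n^'n"
  proof -
    \<comment> \<open>Once the Jordan square is the matrix square, both sides of the Jordan identity
      expand into the same four associative words.\<close>
    have sq: "jordan_product X X = X ** X"
      by (simp add: jordan_product_def flip: scaleR_2)
    show ?thesis
      unfolding sq
      by (simp only: jordan_product_def matrix_mult_bilinear scaleR_add_right scaleR_scaleR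
          matrix_mul_assoc add_ac)
  qed
  moreover have "jordan_product X Y \<in> J" if "X \<in> J" "Y \<in> J" for X Y
    using assms that by (simp add: jordan_product_def subspace_scale)
  ultimately show ?thesis
    using assms(1) unfolding jordan_algebra_on_def by blast
qed

lemma Sym2_nth: "X \<in> Sym2 \<Longrightarrow> X $ 2 $ 1 = X $ 1 $ 2"
  by (simp add: Sym2_def transpose_def vec_eq_iff)

lemma jordan_algebra_on_Sym2: "jordan_algebra_on Sym2 jordan_product"
proof (rule jordan_algebra_on_jordan_product)
  show "subspace Sym2"
    by (auto simp: subspace_def Sym2_def transpose_linear transpose_scalar vec_eq_iff transpose_def)
  show "X ** Y + Y ** X \<in> Sym2" if "X \<in> Sym2" "Y \<in> Sym2" for X Y
    using that by (simp add: Sym2_def transpose_linear matrix_transpose_mul add.commute)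
qed

lemma jordan_algebra_on_RR_Sym2: "jordan_algebra_on RR_Sym2 RR_Sym2_product"
proof -
  have sub: "subspace RR_Sym2"
    using jordan_algebra_on_Sym2 by (auto simp: jordan_algebra_on_def RR_Sym2_def subspace_def zero_prod_def)
  note Sym2 = jordan_algebra_on_Sym2[unfolded jordan_algebra_on_def]
  show ?thesis
    unfolding jordan_algebra_on_def
    using sub Sym2 by (auto simp: RR_Sym2_def algebra_simps)
qed

text \<open>A frame gives the map from the coordinates \<open>K\<close> to \<open>J\<close>,
  opposite to the direction in the definition; its inverse is the required isomorphism.\<close>

lemma jordan_algebra_isomorphicI:
  assumes J: "jordan_algebra_on J p" and K: "jordan_algebra_on K q" and bij: "bij_betw f K J"
    and add: "\<And>x y. x \<in> K \<Longrightarrow> y \<in> K \<Longrightarrow> f (x + y) = f x + f y"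
    and scale: "\<And>r x. x \<in> K \<Longrightarrow> f (r *\<^sub>R x) = r *\<^sub>R f x"
    and mult: "\<And>x y. x \<in> K \<Longrightarrow> y \<in> K \<Longrightarrow> f (q x y) = p (f x) (f y)"
  shows "jordan_algebra_isomorphic J p K q"
proof -
  define g where "g = inv_into K f"
  have g: "g x \<in> K" "f (g x) = x" if "x \<in> J" for x
    using bij that unfolding g_def bij_betw_def by (auto intro: inv_into_into f_inv_into_f)
  have gf: "g (f x) = x" if "x \<in> K" for x
    using bij that by (simp add: g_def bij_betw_def)
  have K': "x + y \<in> K" "r *\<^sub>R x \<in> K" "q x y \<in> K" if "x \<in> K" "y \<in> K" for x y r
    using K that by (auto simp: jordan_algebra_on_def subspace_def)
  have "g (x + y) = g x + g y" if "x \<in> J" "y \<in> J" for x y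
    using gf[of "g x + g y"] add[of "g x" "g y"] K' g that by simp
  moreover have "g (r *\<^sub>R x) = r *\<^sub>R g x" if "x \<in> J" for x r
    using gf[of "r *\<^sub>R g x"] scale[of "g x" r] K'(2)[of "g x" "g x" r] g that by simp
  moreover have "g (p x y) = q (g x) (g y)" if "x \<in> J" "y \<in> J" for x y
    using gf[of "q (g x) (g y)"] mult[of "g x" "g y"] K' g that by simp
  moreover have "bij_betw g J K"
    unfolding g_def using bij by (rule bij_betw_inv_into)
  ultimately show ?thesis
    using J K unfolding jordan_algebra_isomorphic_def by blast
qed

text \<open>The idempotents \<open>u\<close> and \<open>e3\<close> span the two copies of the reals,
  \<open>e1\<close> and \<open>e2\<close> are the diagonal matrix units, and \<open>w\<close> is the
  symmetric matrix with zero diagonal and off-diagonal entries one.\<close>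

lemma Sym2_frame_isomorphic:
  fixes J :: "(real^'n^'n) set"
  assumes J: "J = span {u, w, e1, e2, e3}"
    and jordan: "\<And>X Y. X \<in> J \<Longrightarrow> Y \<in> J \<Longrightarrow> X ** Y + Y ** X \<in> J"
    and nz: "u \<noteq> 0" "w \<noteq> 0" "e1 \<noteq> 0" "e2 \<noteq> 0" "e3 \<noteq> 0"
    and u: "u ** u = u" "u ** w = 0" "u ** e1 = 0" "u ** e2 = 0" "u ** e3 = 0"
      "w ** u = 0" "e1 ** u = 0" "e2 ** u = 0" "e3 ** u = 0"
    and e: "e1 ** e1 = e1" "e2 ** e2 = e2" "e3 ** e3 = e3"
      "e1 ** e2 = 0" "e1 ** e3 = 0" "e2 ** e3 = 0" "e2 ** e1 = 0" "e3 ** e1 = 0" "e3 ** e2 = 0"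
    and w: "e1 ** w = w ** e2" "e2 ** w = w ** e1" "e3 ** w = 0" "w ** e3 = 0"
      "w ** e1 + w ** e2 = w" "w ** w = e1 + e2"
  shows "jordan_algebra_isomorphic J jordan_product RR_Sym2 RR_Sym2_product"
proof -
  define L where "L a b x y z = a *\<^sub>R u + b *\<^sub>R e3 + x *\<^sub>R e1 + y *\<^sub>R e2 + z *\<^sub>R w" for a b x y z
  define f where "f = (\<lambda>(a, b, X :: real^2^2). L a b (X $ 1 $ 1) (X $ 2 $ 2) (X $ 1 $ 2))"
  \<comment> \<open>Eliminating \<open>w ** e2\<close> leaves \<open>w ** e1\<close> as the only
    product outside the span of the frame.\<close>
  have we2: "w ** e2 = w - w ** e1"
    using w(5) by (simp add: algebra_simps)
  note rels = u e w(1-4,6) we2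
  \<comment> \<open>The coefficient of \<open>w ** e1\<close> changes sign when the two factors are
    exchanged, so it disappears from the Jordan product.\<close>
  have mult: "L a b x y z ** L a' b' x' y' z' =
      L (a * a') (b * b') (x * x' + z * z') (y * y' + z * z') (x * z' + z * y') +
      (y * z' + z * x' - x * z' - z * y') *\<^sub>R (w ** e1)" for a b x y z a' b' x' y' z'
    unfolding L_def
    by (simp only: matrix_mult_bilinear rels scaleR_zero_right add_0_left add_0_right scaleR_scaleR)
      (simp add: vec_eq_iff, simp add: algebra_simps)
  have f_mult: "f (RR_Sym2_product p q) = jordan_product (f p) (f q)"
    if "p \<in> RR_Sym2" "q \<in> RR_Sym2" for p q
  proof -
    obtain a b X c d Y where pq: "p = (a, b, X)" "q = (c, d, Y)"
      by (metis prod_cases3)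
    then have sym: "X $ 2 $ 1 = X $ 1 $ 2" "Y $ 2 $ 1 = Y $ 1 $ 2"
      using that Sym2_nth by (auto simp: RR_Sym2_def)
    have XY: "jordan_product X Y $ 1 $ 1 = X $ 1 $ 1 * Y $ 1 $ 1 + X $ 1 $ 2 * Y $ 1 $ 2"
      "jordan_product X Y $ 2 $ 2 = X $ 2 $ 2 * Y $ 2 $ 2 + X $ 1 $ 2 * Y $ 1 $ 2"
      "jordan_product X Y $ 1 $ 2 =
        (X $ 1 $ 1 * Y $ 1 $ 2 + X $ 1 $ 2 * Y $ 2 $ 2 + Y $ 1 $ 1 * X $ 1 $ 2 + Y $ 1 $ 2 * X $ 2 $ 2) / 2"
      by (simp_all add: jordan_product_def matrix_matrix_mult_def sum_2 sym algebra_simps)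
    show ?thesis
      unfolding pq f_def RR_Sym2_product.simps prod.case XY jordan_product_def[of "L _ _ _ _ _"] mult
      unfolding L_def by (simp add: vec_eq_iff) (simp add: field_simps)
  qed
  have f_add: "f (p + q) = f p + f q" for p q
    by (cases p; cases q) (simp add: f_def L_def algebra_simps)
  have f_scale: "f (r *\<^sub>R p) = r *\<^sub>R f p" for r p
    by (cases p) (simp add: f_def L_def algebra_simps)
  have inj: "inj_on f RR_Sym2"
  proof
    fix p q
    assume pq: "p \<in> RR_Sym2" "q \<in> RR_Sym2" "f p = f q"
    obtain a b X c d Y where p: "p = (a, b, X)" and q: "q = (c, d, Y)"
      by (metis prod_cases3)
    have "e1 ** w ** e1 = 0" "e2 ** w ** e2 = 0"
      unfolding w(1,2) by (simp_all add: e flip: matrix_mul_assoc)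
    \<comment> \<open>Multiplication by the idempotents reads off four coordinates; the fifth then
      follows by cancellation.\<close>
    then have L: "u ** L a b x y z = a *\<^sub>R u" "e3 ** L a b x y z = b *\<^sub>R e3"
      "e1 ** L a b x y z ** e1 = x *\<^sub>R e1" "e2 ** L a b x y z ** e2 = y *\<^sub>R e2" for a b x y z
      by (simp_all only: L_def matrix_mult_bilinear u e w(3) scaleR_zero_right add_0_left add_0_right
          times0_left)
    have eq: "L a b (X $ 1 $ 1) (X $ 2 $ 2) (X $ 1 $ 2) = L c d (Y $ 1 $ 1) (Y $ 2 $ 2) (Y $ 1 $ 2)"
      using pq(3) by (simp add: p q f_def)
    have "a *\<^sub>R u = c *\<^sub>R u" "b *\<^sub>R e3 = d *\<^sub>R e3"
      "(X $ 1 $ 1) *\<^sub>R e1 = (Y $ 1 $ 1) *\<^sub>R e1" "(X $ 2 $ 2) *\<^sub>R e2 = (Y $ 2 $ 2) *\<^sub>R e2"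
      by (metis L eq)+
    then have "a = c" "b = d" "X $ 1 $ 1 = Y $ 1 $ 1" "X $ 2 $ 2 = Y $ 2 $ 2"
      using nz by simp_all
    moreover from this have "X $ 1 $ 2 = Y $ 1 $ 2"
      using eq nz by (simp add: L_def)
    ultimately show "p = q"
      using pq(1,2) Sym2_nth by (auto simp: p q RR_Sym2_def vec_eq_iff forall_2)
  qed
  have f_mem: "f p \<in> J" for p
    unfolding J f_def L_def
    by (cases p) (auto intro!: span_add span_scale[OF span_base])
  have surj: "J \<subseteq> f ` RR_Sym2"
  proof
    fix Z
    assume "Z \<in> J"
    then obtain a z x y b where "Z - a *\<^sub>R u - z *\<^sub>R w - x *\<^sub>R e1 - y *\<^sub>R e2 = b *\<^sub>R e3"
      unfolding J by (auto simp: span_breakdown_eq span_singleton)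
    then have "Z = L a b x y z"
      by (simp add: L_def algebra_simps)
    also have "\<dots> = f (a, b, vector [vector [x, z], vector [z, y]])"
      by (simp add: f_def)
    finally show "Z \<in> f ` RR_Sym2"
      by (auto simp: RR_Sym2_def Sym2_def transpose_def vec_eq_iff forall_2)
  qed
  show ?thesis
  proof (rule jordan_algebra_isomorphicI)
    show "jordan_algebra_on J jordan_product"
      using jordan by (intro jordan_algebra_on_jordan_product) (auto simp: J)
    show "bij_betw f RR_Sym2 J"
      using inj surj f_mem by (auto simp: bij_betw_def)
  qed (use jordan_algebra_on_RR_Sym2 f_add f_scale f_mult in auto)
qed

section \<open>Symmetric Jordan configurations\<close>

definition all_ones :: "real^'n^'n" where
  "all_ones = (\<chi> i j. 1)"

lemma all_ones_nth [simp]: "all_ones $ i $ j = 1"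
  by (simp add: all_ones_def)

lemma adjacency_matrix_nth [simp]:
  "adjacency_matrix R $ a $ b = (if (a, b) \<in> R then 1 else 0)"
  by (simp add: adjacency_matrix_def)

lemma matrix_mult_nth: "(A ** B) $ i $ j = (\<Sum>k\<in>UNIV. A $ i $ k * B $ k $ j)"
  by (simp add: matrix_matrix_mult_def)

lemma adjacency_matrix_mult_nth:
  "(adjacency_matrix C ** adjacency_matrix D) $ a $ b = real (card (C `` {a} \<inter> D\<inverse> `` {b}))"
proof -
  have "(adjacency_matrix C ** adjacency_matrix D) $ a $ b =
      (\<Sum>c\<in>UNIV. if c \<in> C `` {a} \<inter> D\<inverse> `` {b} then 1 else 0)"
    unfolding matrix_mult_nth by (intro sum.cong) auto
  also have "\<dots> = real (card (C `` {a} \<inter> D\<inverse> `` {b}))"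
    by (subst sum.If_cases) (simp_all del: Int_iff Image_singleton_iff Image_singleton)
  finally show ?thesis .
qed

lemma adjacency_matrix_Id_on_mult:
  assumes "D \<subseteq> P \<times> P"
  shows "adjacency_matrix (Id_on P) ** adjacency_matrix D = adjacency_matrix D"
    "adjacency_matrix D ** adjacency_matrix (Id_on P) = adjacency_matrix D"
proof -
  have "(adjacency_matrix (Id_on P) ** adjacency_matrix D) $ a $ b = adjacency_matrix D $ a $ b" for a b
  proof -
    have "(adjacency_matrix (Id_on P) ** adjacency_matrix D) $ a $ b =
        (\<Sum>c\<in>UNIV. if c = a then adjacency_matrix D $ a $ b else 0)"
      unfolding matrix_mult_nth using assms by (intro sum.cong) auto
    then show ?thesis
      by simp
  qed
  moreover have "(adjacency_matrix D ** adjacency_matrix (Id_on P)) $ a $ b = adjacency_matrix D $ a $ b" for a b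
  proof -
    have "(adjacency_matrix D ** adjacency_matrix (Id_on P)) $ a $ b =
        (\<Sum>c\<in>UNIV. if c = b then adjacency_matrix D $ a $ b else 0)"
      unfolding matrix_mult_nth using assms by (intro sum.cong) auto
    then show ?thesis
      by simp
  qed
  ultimately show "adjacency_matrix (Id_on P) ** adjacency_matrix D = adjacency_matrix D"
    "adjacency_matrix D ** adjacency_matrix (Id_on P) = adjacency_matrix D"
    by (simp_all add: vec_eq_iff)
qed

section \<open>The span of a symmetric Jordan configuration\<close>

locale symmetric_jordan_configuration =
  fixes \<C> :: "('a::finite) rel set"
  assumes jordan_configuration: "jordan_configuration \<C>"
    and symmetric_configuration: "symmetric_configuration \<C>"
begin

abbreviation S :: "(real^'a^'a) set" where
  "S \<equiv> configuration_span \<C>"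

lemma partition: "partition_on UNIV \<C>"
  using jordan_configuration by (simp add: jordan_configuration_def rainbow_def)

lemma class_unique: "C \<in> \<C> \<Longrightarrow> D \<in> \<C> \<Longrightarrow> x \<in> C \<Longrightarrow> x \<in> D \<Longrightarrow> C = D"
  using partition disjointD[of \<C> C D] by (auto simp: partition_on_def)

lemma class_iff: "C \<in> \<C> \<Longrightarrow> x \<in> C \<Longrightarrow> D \<in> \<C> \<Longrightarrow> x \<in> D \<longleftrightarrow> D = C"
  using class_unique by blast

lemma class_exists: "\<exists>C\<in>\<C>. x \<in> C"
  using partition_onD1[OF partition] by blast

lemma class_nonempty: "C \<in> \<C> \<Longrightarrow> \<exists>a b. (a, b) \<in> C"
  using partition_onD3[OF partition] by (metis ex_in_conv surj_pair)

lemma class_sym: "C \<in> \<C> \<Longrightarrow> (a, b) \<in> C \<Longrightarrow> (b, a) \<in> C"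
  using symmetric_configuration by (metis converse_iff symmetric_configuration_def)

text \<open>Constancy on a class is a linear condition satisfied by every adjacency matrix. Together
  with \<open>mem_spanI\<close> this identifies \<open>S\<close> with the matrices constant on
  classes.\<close>

lemma span_const:
  assumes "X \<in> S" "C \<in> \<C>" "(a, b) \<in> C" "(a', b') \<in> C"
  shows "X $ a $ b = X $ a' $ b'"
proof -
  have "adjacency_matrix ` \<C> \<subseteq> {X. X $ a $ b = X $ a' $ b'}"
    using class_iff[OF assms(2,3)] class_iff[OF assms(2,4)] by auto
  moreover have "subspace {X. X $ a $ b = X $ a' $ b'}"
    by (simp add: subspace_def)
  ultimately have "S \<subseteq> {X. X $ a $ b = X $ a' $ b'}"
    unfolding configuration_span_def by (rule span_minimal)
  then show ?thesis
    using assms(1) by blast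
qed

lemma mem_span_classesI:
  assumes \<D>: "\<D> \<subseteq> \<C>"
    and X: "\<And>C a b a' b'. C \<in> \<D> \<Longrightarrow> (a, b) \<in> C \<Longrightarrow> (a', b') \<in> C \<Longrightarrow> X $ a $ b = X $ a' $ b'"
    and zero: "\<And>C a b. C \<in> \<C> - \<D> \<Longrightarrow> (a, b) \<in> C \<Longrightarrow> X $ a $ b = 0"
  shows "X \<in> span (adjacency_matrix ` \<D>)"
proof -
  \<comment> \<open>The coefficient of a class is the entry at an arbitrarily chosen pair; constancy
    makes the choice immaterial for the classes in \<D>.\<close>
  define c where "c C = X $ fst (SOME p. p \<in> C) $ snd (SOME p. p \<in> C)" for C :: "'a rel"
  have "X = (\<Sum>C\<in>\<D>. c C *\<^sub>R adjacency_matrix C)"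
  proof -
    have "X $ a $ b = (\<Sum>C\<in>\<D>. c C *\<^sub>R adjacency_matrix C) $ a $ b" for a b
    proof -
      obtain C0 where C0: "C0 \<in> \<C>" "(a, b) \<in> C0"
        using class_exists by blast
      then have some: "(SOME p. p \<in> C0) \<in> C0"
        by (meson someI)
      have "(\<Sum>C\<in>\<D>. c C *\<^sub>R adjacency_matrix C) $ a $ b =
          (\<Sum>C\<in>\<D>. if C = C0 then c C else 0)"
        unfolding sum_component using \<D> by (intro sum.cong) (auto simp: class_iff[OF C0])
      also have "\<dots> = (if C0 \<in> \<D> then c C0 else 0)"
        by simp
      also have "\<dots> = X $ a $ b"
      proof (cases "C0 \<in> \<D>")
        case True
        then show ?thesis
          unfolding c_def
          using X[of C0 "fst (SOME p. p \<in> C0)" "snd (SOME p. p \<in> C0)" a b] C0(2) some by simp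
      next
        case False
        then show ?thesis
          using zero[of C0 a b] C0 by simp
      qed
      finally show ?thesis ..
    qed
    then show ?thesis
      by (simp add: vec_eq_iff)
  qed
  also have "\<dots> \<in> span (adjacency_matrix ` \<D>)"
    by (intro span_sum span_scale span_base) auto
  finally show ?thesis .
qed

lemma mem_spanI:
  assumes "\<And>C a b a' b'. C \<in> \<C> \<Longrightarrow> (a, b) \<in> C \<Longrightarrow> (a', b') \<in> C \<Longrightarrow> X $ a $ b = X $ a' $ b'"
  shows "X \<in> S"
  unfolding configuration_span_def by (rule mem_span_classesI) (use assms in blast)+

lemma subspace_S: "subspace S"
  by (simp add: configuration_span_def)

lemma adjacency_mem: "C \<in> \<C> \<Longrightarrow> adjacency_matrix C \<in> S"
  by (simp add: configuration_span_def span_base)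

lemma S_sym:
  assumes "X \<in> S"
  shows "X $ a $ b = X $ b $ a"
proof -
  obtain C where C: "C \<in> \<C>" "(a, b) \<in> C"
    using class_exists by blast
  show ?thesis
    by (rule span_const[OF assms C(1) C(2) class_sym[OF C]])
qed

lemma transpose_S: "X \<in> S \<Longrightarrow> transpose X = X"
  using S_sym by (simp add: vec_eq_iff transpose_def)

lemma all_ones_mem: "all_ones \<in> S"
  by (rule mem_spanI) simp

lemma one_mem: "mat 1 \<in> S"
proof -
  obtain \<D> where \<D>: "\<D> \<subseteq> \<C>" "\<Union>\<D> = Id"
    using jordan_configuration by (auto simp: jordan_configuration_def rainbow_def)
  \<comment> \<open>A union of classes contains or misses each class, so no class mixes diagonal and
    off-diagonal pairs.\<close>
  have *: "a = b \<longleftrightarrow> a' = b'" if "C \<in> \<C>" "(a, b) \<in> C" "(a', b') \<in> C" for C a b a' b'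
  proof -
    have "(a, b) \<in> Id \<longleftrightarrow> C \<in> \<D>" "(a', b') \<in> Id \<longleftrightarrow> C \<in> \<D>"
      using \<D>(1) that class_unique unfolding \<D>(2)[symmetric] by blast+
    then show ?thesis
      by auto
  qed
  show ?thesis
  proof (rule mem_spanI)
    fix C a b a' b'
    assume "C \<in> \<C>" "(a, b) \<in> C" "(a', b') \<in> C"
    from *[OF this] show "mat 1 $ a $ b = (mat 1 :: real^'a^'a) $ a' $ b'"
      by (simp add: mat_def)
  qed
qed

text \<open>For adjacency matrices the entries are the sums of intersection numbers in the
  definition of a Jordan configuration. Linearity extends this to \<open>S\<close>, one argument at
  a time.\<close>

lemma jordan_S:
  assumes "X \<in> S" "Y \<in> S"
  shows "X ** Y + Y ** X \<in> S"
proof -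
  have 1: "adjacency_matrix C ** adjacency_matrix D + adjacency_matrix D ** adjacency_matrix C \<in> S"
    if CD: "C \<in> \<C>" "D \<in> \<C>" for C D
  proof (rule mem_spanI)
    fix B a b a' b'
    assume B: "B \<in> \<C>" and ab: "(a, b) \<in> B" "(a', b') \<in> B"
    note conjunct2[OF jordan_configuration[unfolded jordan_configuration_def], rule_format, OF CD B]
    from this[OF ab(1)] ab(2) have "card (C `` {a} \<inter> D\<inverse> `` {b}) + card (D `` {a} \<inter> C\<inverse> `` {b}) =
        card (C `` {a'} \<inter> D\<inverse> `` {b'}) + card (D `` {a'} \<inter> C\<inverse> `` {b'})"
      by auto
    then show "(adjacency_matrix C ** adjacency_matrix D + adjacency_matrix D ** adjacency_matrix C) $ a $ b =
        (adjacency_matrix C ** adjacency_matrix D + adjacency_matrix D ** adjacency_matrix C) $ a' $ b'"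
      by (simp add: adjacency_matrix_mult_nth del: of_nat_add flip: of_nat_add)
  qed
  have sub: "subspace {Y. X ** Y + Y ** X \<in> S}" for X
  proof -
    have "X ** (Y + Z) + (Y + Z) ** X = (X ** Y + Y ** X) + (X ** Z + Z ** X)" for Y Z
      by (simp add: matrix_mult_bilinear)
    moreover have "X ** (r *\<^sub>R Y) + (r *\<^sub>R Y) ** X = r *\<^sub>R (X ** Y + Y ** X)" for r Y
      by (simp add: matrix_mult_bilinear scaleR_add_right)
    ultimately show ?thesis
      using subspace_S by (simp add: subspace_def)
  qed
  have 2: "adjacency_matrix C ** Y + Y ** adjacency_matrix C \<in> S" if C: "C \<in> \<C>" for C
  proof -
    have "adjacency_matrix ` \<C> \<subseteq> {Y. adjacency_matrix C ** Y + Y ** adjacency_matrix C \<in> S}"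
      using 1 C by blast
    from span_minimal[OF this sub] show ?thesis
      using assms(2) unfolding configuration_span_def[of \<C>] by blast
  qed
  have "adjacency_matrix ` \<C> \<subseteq> {X. Y ** X + X ** Y \<in> S}"
    using 2 by (auto simp: add.commute)
  from span_minimal[OF this sub] show ?thesis
    using assms(1) unfolding configuration_span_def[of \<C>] by (auto simp: add.commute)
qed

lemma commuting_mult_S:
  assumes "X \<in> S" "Y \<in> S" "X ** Y = Y ** X"
  shows "X ** Y \<in> S"
proof -
  have "(1/2) *\<^sub>R (X ** Y + Y ** X) \<in> S"
    using jordan_S[OF assms(1,2)] subspace_S by (rule subspace_scale[rotated])
  then show ?thesis
    using assms(3) by (simp flip: scaleR_add_left)
qed

text \<open>By symmetry of \<open>X\<close> the diagonal entries of
  \<open>X ** all_ones + all_ones ** X\<close> are twice its row sums, and this matrix lies in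
  \<open>S\<close>.\<close>

lemma row_sum_const:
  assumes X: "X \<in> S" and F: "F \<in> \<C>" "(a, a) \<in> F" "(b, b) \<in> F"
  shows "(\<Sum>c\<in>UNIV. X $ a $ c) = (\<Sum>c\<in>UNIV. X $ b $ c)"
proof -
  have *: "(X ** all_ones + all_ones ** X) $ a $ a = 2 * (\<Sum>c\<in>UNIV. X $ a $ c)" for a
    using S_sym[OF X, of _ a] by (simp add: matrix_matrix_mult_def)
  have "(X ** all_ones + all_ones ** X) $ a $ a = (X ** all_ones + all_ones ** X) $ b $ b"
    using span_const[OF jordan_S[OF X all_ones_mem] F] .
  then show ?thesis
    by (simp only: *)
qed

lemma dim_S: "dim S = card \<C>"
proof -
  have inj: "inj_on adjacency_matrix \<C>"
  proof
    fix C D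
    assume CD: "C \<in> \<C>" "D \<in> \<C>" "adjacency_matrix C = adjacency_matrix D"
    obtain a b where ab: "(a, b) \<in> C"
      using CD class_nonempty by blast
    then have "adjacency_matrix D $ a $ b = 1"
      using CD(3) by (metis adjacency_matrix_nth)
    then have "(a, b) \<in> D"
      by (simp split: if_splits)
    then show "C = D"
      using CD ab class_unique by blast
  qed
  have "independent (adjacency_matrix ` \<C>)"
  proof (rule independent_if_scalars_zero)
    fix f X
    assume "(\<Sum>X\<in>adjacency_matrix ` \<C>. f X *\<^sub>R X) = 0" and "X \<in> adjacency_matrix ` \<C>"
    then obtain C where C: "C \<in> \<C>" "X = adjacency_matrix C"
      and sum: "(\<Sum>C\<in>\<C>. f (adjacency_matrix C) *\<^sub>R adjacency_matrix C) = 0"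
      using inj by (auto simp: sum.reindex)
    obtain a b where "(a, b) \<in> C"
      using C class_nonempty by blast
    then have "(\<Sum>C\<in>\<C>. f (adjacency_matrix C) *\<^sub>R adjacency_matrix C) $ a $ b =
        (\<Sum>D\<in>\<C>. if D = C then f (adjacency_matrix C) else 0)"
      unfolding sum_component using C(1) by (intro sum.cong) (simp_all add: class_iff[of C])
    then show "f X = 0"
      using sum C by simp
  qed simp
  then show ?thesis
    using inj by (simp add: configuration_span_def dim_eq_card_independent card_image)
qed

text \<open>Products of commuting elements are Jordan products, entrywise products stay constant on
  classes, and all matrices in \<open>S\<close> are symmetric.\<close>

lemma not_proper_if_commutative:
  assumes "\<And>X Y. X \<in> S \<Longrightarrow> Y \<in> S \<Longrightarrow> X ** Y = Y ** X"
  shows "\<not> proper_configuration \<C>"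
proof -
  have "(\<chi> a b. X $ a $ b * Y $ a $ b) \<in> S" if "X \<in> S" "Y \<in> S" for X Y
  proof (rule mem_spanI)
    fix C a b a' b'
    assume "C \<in> \<C>" "(a, b) \<in> C" "(a', b') \<in> C"
    then have "X $ a $ b = X $ a' $ b'" "Y $ a $ b = Y $ a' $ b'"
      using span_const that by blast+
    then show "(\<chi> a b. X $ a $ b * Y $ a $ b) $ a $ b = (\<chi> a b. X $ a $ b * Y $ a $ b) $ a' $ b'"
      by simp
  qed
  then have "coherent_algebra S"
    using subspace_S one_mem all_ones_mem transpose_S commuting_mult_S assms
    by (auto simp: coherent_algebra_def all_ones_def)
  moreover have "S = symmetrization S"
    using transpose_S by (auto simp: symmetrization_def)
  ultimately show ?thesis
    by (auto simp: proper_configuration_def)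
qed

text \<open>The entries of \<open>A\<^sub>P \<one> + \<one> A\<^sub>P\<close> count the endpoints in \<open>P\<close>.\<close>

lemma fiber_count:
  assumes F: "Id_on P \<in> \<C>" and C: "C \<in> \<C>" "(a, b) \<in> C" "(a', b') \<in> C"
  shows "(of_bool (a \<in> P) + of_bool (b \<in> P) :: nat) =
    of_bool (a' \<in> P) + of_bool (b' \<in> P)"
proof -
  let ?X = "adjacency_matrix (Id_on P) ** all_ones + all_ones ** adjacency_matrix (Id_on P)"
  have *: "?X $ a $ b = real (of_bool (a \<in> P) + of_bool (b \<in> P))" for a b
  proof -
    have "(adjacency_matrix (Id_on P) ** all_ones) $ a $ b = (\<Sum>c\<in>UNIV. if c = a then of_bool (a \<in> P) else 0)"
      unfolding matrix_mult_nth by (intro sum.cong) auto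
    moreover have "(all_ones ** adjacency_matrix (Id_on P)) $ a $ b = (\<Sum>c\<in>UNIV. if c = b then of_bool (b \<in> P) else 0)"
      unfolding matrix_mult_nth by (intro sum.cong) auto
    ultimately show ?thesis
      by simp
  qed
  have "?X $ a $ b = ?X $ a' $ b'"
    using span_const[OF jordan_S[OF adjacency_mem[OF F] all_ones_mem] C] .
  then show ?thesis
    unfolding * by linarith
qed

text \<open>In the nontrivial case \<open>C\<close> and \<open>D\<close> are the only non-diagonal
  classes of the block, so \<open>D\<close> is the all-one block minus the diagonal and
  \<open>C\<close>. Constant row sums make \<open>C\<close> commute with the all-one block.\<close>

lemma block_commute:
  assumes F: "Id_on P \<in> \<C>" and card: "card {C \<in> \<C>. C \<subseteq> P \<times> P} \<le> 3"
    and C: "C \<in> \<C>" "C \<subseteq> P \<times> P" and D: "D \<in> \<C>" "D \<subseteq> P \<times> P"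
  shows "adjacency_matrix C ** adjacency_matrix D = adjacency_matrix D ** adjacency_matrix C"
proof (cases "C = D \<or> C = Id_on P \<or> D = Id_on P")
  case True
  then show ?thesis
    using adjacency_matrix_Id_on_mult C D by metis
next
  case False
  have sub: "{Id_on P, C, D} \<subseteq> {C \<in> \<C>. C \<subseteq> P \<times> P}"
    using F C D by auto
  moreover have "card {Id_on P, C, D} = 3"
    using False by (simp add: card_insert_if eq_commute)
  ultimately have classes: "{C \<in> \<C>. C \<subseteq> P \<times> P} = {Id_on P, C, D}"
    using card by (intro card_seteq[symmetric]) auto
  let ?K = "adjacency_matrix (P \<times> P)"
  have K: "?K = adjacency_matrix (Id_on P) + adjacency_matrix C + adjacency_matrix D"
  proof -
    have "?K $ a $ b = (adjacency_matrix (Id_on P) + adjacency_matrix C + adjacency_matrix D) $ a $ b" for a b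
    proof (cases "a \<in> P \<and> b \<in> P")
      case ab: True
      obtain B where B: "B \<in> \<C>" "(a, b) \<in> B"
        using class_exists by blast
      \<comment> \<open>One pair of \<open>B\<close> has both endpoints in \<open>P\<close>, so the
        endpoint count is two on all of \<open>B\<close>.\<close>
      have "B \<subseteq> P \<times> P"
      proof clarify
        fix c d
        assume "(c, d) \<in> B"
        from fiber_count[OF F B this] show "c \<in> P \<and> d \<in> P"
          using ab by (cases "c \<in> P"; cases "d \<in> P") simp_all
      qed
      then have "B \<in> {Id_on P, C, D}"
        using B classes by blast
      moreover have "(a, b) \<in> B' \<longleftrightarrow> B' = B" if "B' \<in> {Id_on P, C, D}" for B'
        using that B(1) F C D class_iff[OF B] by blast
      ultimately show ?thesis
        using ab False by auto
    next
      case False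
      then show ?thesis
        using C D by auto
    qed
    then show ?thesis
      by (simp add: vec_eq_iff)
  qed
  have "adjacency_matrix C ** ?K = ?K ** adjacency_matrix C"
  proof -
    have sum: "(\<Sum>c\<in>UNIV. adjacency_matrix C $ a $ c) = (\<Sum>c\<in>UNIV. adjacency_matrix C $ b $ c)"
      if "a \<in> P" "b \<in> P" for a b
      using that row_sum_const[OF adjacency_mem[OF C(1)] F] by auto
    have left: "(adjacency_matrix C ** ?K) $ a $ b = of_bool (b \<in> P) * (\<Sum>c\<in>UNIV. adjacency_matrix C $ a $ c)" for a b
      unfolding matrix_mult_nth sum_distrib_left using C by (intro sum.cong) auto
    have right: "(?K ** adjacency_matrix C) $ a $ b = of_bool (a \<in> P) * (\<Sum>c\<in>UNIV. adjacency_matrix C $ b $ c)" for a b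
      unfolding matrix_mult_nth sum_distrib_left using C class_sym[OF C(1)] by (intro sum.cong) auto
    have zero: "(\<Sum>c\<in>UNIV. adjacency_matrix C $ a $ c) = 0" if "a \<notin> P" for a
      using C that by (intro sum.neutral) auto
    have "(adjacency_matrix C ** ?K) $ a $ b = (?K ** adjacency_matrix C) $ a $ b" for a b
      unfolding left right using sum[of a b] zero[of a] zero[of b]
      by (cases "a \<in> P"; cases "b \<in> P") (simp_all only: of_bool_eq mult_1 mult_zero_left simp_thms)
    then show ?thesis
      by (simp add: vec_eq_iff)
  qed
  moreover have D_eq: "adjacency_matrix D = ?K - adjacency_matrix (Id_on P) - adjacency_matrix C"
    unfolding K by simp
  ultimately show ?thesis
    unfolding D_eq by (simp add: matrix_mult_bilinear adjacency_matrix_Id_on_mult[OF C(2)])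
qed

end

subsection \<open>The homogeneous case\<close>

lemma all_ones_square: "all_ones ** all_ones = real CARD('n) *\<^sub>R (all_ones :: real^'n^'n)"
  by (simp add: vec_eq_iff matrix_mult_nth)

lemma trace_all_ones: "trace (all_ones :: real^'n^'n) = real CARD('n)"
  by (simp add: trace_def)

context symmetric_jordan_configuration
begin

text \<open>The Peirce 0-space in \<open>S\<close> of the idempotent obtained by dividing
  \<open>all_ones\<close> by the number of points.\<close>

definition corner :: "(real^'a^'a) set" where
  "corner = {X \<in> S. X ** all_ones = 0}"

definition corner_unit :: "real^'a^'a" where
  "corner_unit = mat 1 - (1 / real CARD('a)) *\<^sub>R all_ones"

lemma cornerD: "X \<in> corner \<Longrightarrow> X \<in> S" "X \<in> corner \<Longrightarrow> X ** all_ones = 0"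
  by (simp_all add: corner_def)

lemma corner_left: "X \<in> corner \<Longrightarrow> all_ones ** X = 0"
  using transpose_S[OF all_ones_mem] transpose_S[of X] cornerD[of X]
  by (metis mat_0 matrix_transpose_mul transpose_mat)

sublocale corner: matrix_jordan_algebra corner corner_unit
proof
  have sub: "0 \<in> S" "X \<in> S \<Longrightarrow> Y \<in> S \<Longrightarrow> X + Y \<in> S" "X \<in> S \<Longrightarrow> Y \<in> S \<Longrightarrow> X - Y \<in> S" "X \<in> S \<Longrightarrow> r *\<^sub>R X \<in> S"
    for X Y r
    using subspace_S by (simp_all add: subspace_0 subspace_add subspace_diff subspace_scale)
  show "subspace corner"
    by (auto simp: subspace_def corner_def sub matrix_mult_bilinear)
  show "corner_unit \<in> corner"
    using sub one_mem all_ones_mem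
    by (simp add: corner_def corner_unit_def matrix_mult_bilinear all_ones_square)
  show "corner_unit ** X = X" if "X \<in> corner" for X
    using that corner_left by (simp add: corner_unit_def matrix_mult_bilinear)
  show "transpose X = X" if "X \<in> corner" for X
    using that cornerD transpose_S by blast
  show "X ** Y + Y ** X \<in> corner" if XY: "X \<in> corner" "Y \<in> corner" for X Y
  proof -
    have "X ** Y ** all_ones = 0" "Y ** X ** all_ones = 0"
      unfolding matrix_mul_assoc[symmetric] cornerD(2)[OF XY(1)] cornerD(2)[OF XY(2)] by simp_all
    then show ?thesis
      using jordan_S[OF cornerD(1)[OF XY(1)] cornerD(1)[OF XY(2)]]
      by (simp add: corner_def matrix_mult_bilinear)
  qed
qed

lemma trace_corner_unit: "trace corner_unit = real CARD('a) - 1"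
  by (simp add: corner_unit_def trace_sub trace_scaleR trace_all_ones trace_I)

context
  assumes Id_mem: "Id \<in> \<C>"
begin

text \<open>With a single diagonal class all row sums of \<open>X\<close> agree with the one at the
  arbitrary point \<open>a\<close>; the second identity is the transpose of the first.\<close>

lemma mult_all_ones:
  assumes "X \<in> S"
  shows "X ** all_ones = (\<Sum>c\<in>UNIV. X $ a $ c) *\<^sub>R all_ones"
    and "all_ones ** X = (\<Sum>c\<in>UNIV. X $ a $ c) *\<^sub>R all_ones"
proof -
  have sum: "(\<Sum>c\<in>UNIV. X $ b $ c) = (\<Sum>c\<in>UNIV. X $ a $ c)" for b
    using row_sum_const[OF assms Id_mem] by simp
  show "X ** all_ones = (\<Sum>c\<in>UNIV. X $ a $ c) *\<^sub>R all_ones"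
  proof -
    have "(X ** all_ones) $ b $ c = ((\<Sum>c\<in>UNIV. X $ a $ c) *\<^sub>R all_ones) $ b $ c" for b c
      using sum[of b] by (simp add: matrix_mult_nth)
    then show ?thesis
      unfolding vec_eq_iff by blast
  qed
  have "all_ones ** X = transpose (X ** all_ones)"
    using transpose_S[OF assms] transpose_S[OF all_ones_mem] by (simp add: matrix_transpose_mul)
  also have "\<dots> = (\<Sum>c\<in>UNIV. X $ a $ c) *\<^sub>R all_ones"
    unfolding \<open>X ** all_ones = _\<close> using transpose_S[OF all_ones_mem] by (simp add: transpose_scalar)
  finally show "all_ones ** X = (\<Sum>c\<in>UNIV. X $ a $ c) *\<^sub>R all_ones" .
qed

lemma corner_part:
  assumes "X \<in> S"
  shows "X - ((\<Sum>c\<in>UNIV. X $ a $ c) / real CARD('a)) *\<^sub>R all_ones \<in> corner"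
proof -
  define k where "k = (\<Sum>c\<in>UNIV. X $ a $ c)"
  have "X ** all_ones = k *\<^sub>R all_ones"
    unfolding k_def by (rule mult_all_ones(1)[OF assms])
  moreover have "X - (k / real CARD('a)) *\<^sub>R all_ones \<in> S"
    by (intro subspace_diff subspace_scale subspace_S assms all_ones_mem)
  ultimately show ?thesis
    unfolding k_def[symmetric] by (simp add: corner_def matrix_mult_bilinear all_ones_square)
qed

lemma S_eq_span_corner: "S = span (insert all_ones corner)"
proof
  show "S \<subseteq> span (insert all_ones corner)"
  proof
    fix X
    assume "X \<in> S"
    \<comment> \<open>Here \<open>undefined\<close> is just some point; the row sum is the same at
      every point.\<close>
    then have "X - ((\<Sum>c\<in>UNIV. X $ undefined $ c) / real CARD('a)) *\<^sub>R all_ones \<in> span corner"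
      by (intro span_base corner_part)
    then show "X \<in> span (insert all_ones corner)"
      unfolding span_breakdown_eq by blast
  qed
  show "span (insert all_ones corner) \<subseteq> S"
    using all_ones_mem cornerD subspace_S by (intro span_minimal) auto
qed

lemma dim_corner: "card \<C> = dim corner + 1"
proof -
  have "all_ones \<notin> corner"
    by (simp add: corner_def all_ones_square vec_eq_iff)
  then have "all_ones \<notin> span corner"
    using corner.subspace_J by (simp add: span_eq_iff[THEN iffD2])
  then show ?thesis
    using dim_S unfolding S_eq_span_corner by (simp add: dim_insert)
qed

lemma not_proper_if_corner_commutative:
  assumes "\<And>X Y. X \<in> corner \<Longrightarrow> Y \<in> corner \<Longrightarrow> X ** Y = Y ** X"
  shows "\<not> proper_configuration \<C>"
proof (rule not_proper_if_commutative)
  fix X Y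
  assume "X \<in> S" "Y \<in> S"
  moreover have "u ** v = v ** u" if "u \<in> insert all_ones corner" "v \<in> insert all_ones corner" for u v
    using that assms corner_left cornerD by auto
  ultimately show "X ** Y = Y ** X"
    unfolding S_eq_span_corner by (rule span_commute[rotated])
qed

lemma not_proper_rank_le_3:
  assumes "card \<C> \<le> 3"
  shows "\<not> proper_configuration \<C>"
proof (rule not_proper_if_commutative)
  \<comment> \<open>For \<open>P = UNIV\<close> the block is the whole configuration, so
    \<open>block_commute\<close> applies to all of it.\<close>
  have "Id_on UNIV = (Id :: 'a rel)"
    by auto
  fix X Y
  assume "X \<in> S" "Y \<in> S"
  moreover have "u ** v = v ** u" if "u \<in> adjacency_matrix ` \<C>" "v \<in> adjacency_matrix ` \<C>" for u v
    using that block_commute[of UNIV] Id_mem assms unfolding \<open>Id_on UNIV = Id\<close> by auto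
  ultimately show "X ** Y = Y ** X"
    unfolding configuration_span_def by (rule span_commute[rotated])
qed

text \<open>If every corner element is quadratic, then each non-diagonal class is a strongly regular
  graph with \<open>A\<^sup>2 = tA + bI + c\<one>\<close>, so that \<open>t\<close> is an integer, and \<open>trace_quadratic\<close> yields
  \<open>t (n - 1) = - 2k\<close>. Hence \<open>t \<le> -1\<close>.\<close>

lemma valency_lower_bound:
  assumes quad: "\<And>X. X \<in> corner \<Longrightarrow> \<exists>t b. X ** X = t *\<^sub>R X + b *\<^sub>R corner_unit"
    and card: "card \<C> \<ge> 4" and C: "C \<in> \<C>" "C \<noteq> Id"
  shows "real CARD('a) - 1 \<le> 2 * (\<Sum>c\<in>UNIV. adjacency_matrix C $ a $ c)"
proof -
  let ?A = "adjacency_matrix C" and ?n = "real CARD('a)"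
  define k where "k = (\<Sum>c\<in>UNIV. ?A $ a $ c)"
  obtain x y where xy: "(x, y) \<in> C"
    using C class_nonempty by blast
  then have "x \<noteq> y"
    using C Id_mem class_unique by blast
  \<comment> \<open>A second non-diagonal class supplies an off-diagonal pair \<open>(u, v)\<close>
    at which \<open>?A\<close> vanishes, to be compared with \<open>(x, y)\<close> in
    \<open>C\<close>.\<close>
  have "\<not> \<C> \<subseteq> {Id, C}"
    using card card_mono[of "{Id, C}" \<C>] C by (auto simp: card_insert_if)
  then obtain D where D: "D \<in> \<C>" "D \<noteq> Id" "D \<noteq> C"
    by blast
  obtain u v where uv: "(u, v) \<in> D"
    using D class_nonempty by blast
  have "u \<noteq> v"
    using D Id_mem uv class_unique by blast
  have "(u, v) \<notin> C"
    using D C uv class_unique by blast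
  have "?A $ x $ y \<le> (\<Sum>c\<in>UNIV. ?A $ x $ c)"
    by (intro member_le_sum) auto
  also have "(\<Sum>c\<in>UNIV. ?A $ x $ c) = k"
    unfolding k_def using row_sum_const[OF adjacency_mem[OF C(1)] Id_mem] by simp
  finally have "k \<ge> 1"
    using xy by simp
  have n: "?n \<ge> 2"
    using card_mono[of UNIV "{x, y}"] \<open>x \<noteq> y\<close> by simp
  define X where "X = ?A - (k / ?n) *\<^sub>R all_ones"
  have X: "X \<in> corner"
    unfolding X_def k_def by (intro corner_part adjacency_mem C)
  \<comment> \<open>Off the diagonal \<open>corner_unit\<close> is constant, whereas
    \<open>X\<close> differs at the two pairs.\<close>
  have "X \<notin> span {corner_unit}"
  proof
    assume "X \<in> span {corner_unit}"
    then obtain s where s: "X = s *\<^sub>R corner_unit"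
      by (auto simp: span_singleton)
    have "X $ x $ y = X $ u $ v"
      unfolding s using \<open>x \<noteq> y\<close> \<open>u \<noteq> v\<close> by (simp add: corner_unit_def mat_def)
    then show False
      using xy \<open>(u, v) \<notin> C\<close> by (simp add: X_def)
  qed
  obtain t b where tb: "X ** X = t *\<^sub>R X + b *\<^sub>R corner_unit"
    using quad X by blast
  have "trace ?A = 0"
    unfolding trace_def using C Id_mem class_unique by (intro sum.neutral) auto
  then have "trace X = - k"
    by (simp add: X_def trace_sub trace_scaleR trace_all_ones)
  moreover have "2 * trace X = t * trace corner_unit"
    using corner.trace_quadratic[OF quad _ X tb] \<open>X \<notin> _\<close> card dim_corner by simp
  ultimately have kt: "2 * k = - t * (?n - 1)"
    by (simp add: trace_corner_unit)
  have "t < 0"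
  proof (rule ccontr)
    assume "\<not> t < 0"
    then have "- t * (?n - 1) \<le> 0"
      using n by simp
    then show False
      using kt \<open>k \<ge> 1\<close> by simp
  qed
  \<comment> \<open>Subtracting the entries at the two pairs cancels the multiples of
    \<open>corner_unit\<close> and \<open>all_ones\<close>. What remains is a difference of numbers
    of common neighbours.\<close>
  have "t = (?A ** ?A) $ x $ y - (?A ** ?A) $ u $ v"
  proof -
    have "X $ x $ y - X $ u $ v = 1"
      using xy \<open>(u, v) \<notin> C\<close> by (simp add: X_def)
    moreover have "corner_unit $ x $ y - corner_unit $ u $ v = 0"
      using \<open>x \<noteq> y\<close> \<open>u \<noteq> v\<close> by (simp add: corner_unit_def mat_def)
    moreover have "(X ** X) $ x $ y - (X ** X) $ u $ v =
        t * (X $ x $ y - X $ u $ v) + b * (corner_unit $ x $ y - corner_unit $ u $ v)"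
      unfolding tb by (simp add: right_diff_distrib)
    ultimately have "t = (X ** X) $ x $ y - (X ** X) $ u $ v"
      by simp
    also have "X ** X = X ** ?A"
      using cornerD(2)[OF X] by (subst (2) X_def) (simp add: matrix_mult_bilinear)
    also have "\<dots> = ?A ** ?A - (k / ?n * k) *\<^sub>R all_ones"
      using mult_all_ones(2)[OF adjacency_mem[OF C(1)], of a]
      by (simp add: X_def matrix_mult_bilinear k_def)
    finally show ?thesis
      by simp
  qed
  then have "t \<in> \<int>"
    by (simp add: adjacency_matrix_mult_nth)
  then have "t \<le> - 1"
    using \<open>t < 0\<close> by (auto elim!: Ints_cases)
  then have "1 * (?n - 1) \<le> - t * (?n - 1)"
    using n by (intro mult_right_mono) auto
  then show ?thesis
    using kt by (simp add: k_def)
qed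

text \<open>Otherwise \<open>valency_lower_bound\<close> gives at least three non-diagonal classes
  of valency at least \<open>(n - 1)/2\<close>, while these valencies add up to
  \<open>n - 1\<close>, which is positive.\<close>

lemma exists_nonquadratic:
  assumes card: "card \<C> \<ge> 4"
  obtains A where "A \<in> corner" "\<And>t b. A ** A \<noteq> t *\<^sub>R A + b *\<^sub>R corner_unit"
proof (cases "\<forall>A\<in>corner. \<exists>t b. A ** A = t *\<^sub>R A + b *\<^sub>R corner_unit")
  case True
  fix a :: 'a
  let ?n = "real CARD('a)" and ?k = "\<lambda>C. \<Sum>c\<in>UNIV. adjacency_matrix C $ a $ c"
  have "(\<Sum>C\<in>\<C>. ?k C) = (\<Sum>c\<in>UNIV. \<Sum>C\<in>\<C>. adjacency_matrix C $ a $ c)"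
    by (rule sum.swap)
  also have "\<dots> = (\<Sum>c\<in>(UNIV :: 'a set). 1)"
  proof (rule sum.cong)
    fix c :: 'a
    obtain C0 where C0: "C0 \<in> \<C>" "(a, c) \<in> C0"
      using class_exists by blast
    have "(\<Sum>C\<in>\<C>. adjacency_matrix C $ a $ c) = (\<Sum>C\<in>\<C>. if C = C0 then 1 else 0)"
      by (intro sum.cong) (simp_all add: class_iff[OF C0])
    then show "(\<Sum>C\<in>\<C>. adjacency_matrix C $ a $ c) = 1"
      using C0 by simp
  qed simp
  finally have total: "(\<Sum>C\<in>\<C>. ?k C) = ?n"
    by simp
  have "?k Id = 1"
    by simp
  then have rest: "(\<Sum>C\<in>\<C> - {Id}. ?k C) = ?n - 1"
    using total Id_mem by (subst sum_diff1) auto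
  have "(\<Sum>C\<in>\<C> - {Id}. (?n - 1) / 2) \<le> (\<Sum>C\<in>\<C> - {Id}. ?k C)"
    using valency_lower_bound[OF _ card, of _ a] True by (intro sum_mono) fastforce
  then have "real (card \<C> - 1) * ((?n - 1) / 2) \<le> ?n - 1"
    using rest Id_mem by simp
  moreover have "?n > 1"
  proof -
    have "\<not> \<C> \<subseteq> {Id}"
      using card card_mono[of "{Id}" \<C>] by auto
    then obtain C where C: "C \<in> \<C>" "C \<noteq> Id"
      by blast
    then obtain x y where "(x, y) \<in> C"
      using class_nonempty by blast
    then have "x \<noteq> y"
      using C Id_mem class_unique by blast
    then show ?thesis
      using card_mono[of UNIV "{x, y}"] by simp
  qed
  moreover have "real (card \<C> - 1) \<ge> 3"
    using card by simp
  ultimately have "3 * ((?n - 1) / 2) \<le> ?n - 1"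
    using mult_right_mono[of 3 "real (card \<C> - 1)" "(?n - 1) / 2"] by linarith
  then show ?thesis
    using \<open>?n > 1\<close> by simp
qed (use that in blast)

lemma not_proper_rank_4:
  assumes "card \<C> = 4"
  shows "\<not> proper_configuration \<C>"
proof -
  obtain A where A: "A \<in> corner" "\<And>t b. A ** A \<noteq> t *\<^sub>R A + b *\<^sub>R corner_unit"
    using exists_nonquadratic assms by (metis order_refl)
  have "dim corner \<le> 3"
    using dim_corner assms by simp
  from corner.commute_dim_3[OF A this] show ?thesis
    by (rule not_proper_if_corner_commutative)
qed

end

end

subsection \<open>The inhomogeneous case\<close>

context symmetric_jordan_configuration
begin

definition block :: "'a set \<Rightarrow> 'a rel set" where
  "block P = {C \<in> \<C>. C \<subseteq> P \<times> P}"

text \<open>The bounds on the blocks are those of \<open>block_commute\<close>; the last clause says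
  that a class meeting \<open>P \<times> - P\<close> contains all of it.\<close>

definition two_fibers :: "'a set \<Rightarrow> bool" where
  "two_fibers P \<longleftrightarrow> Id_on P \<in> \<C> \<and> Id_on (- P) \<in> \<C> \<and> card (block P) \<le> 3 \<and> card (block (- P)) \<le> 3 \<and>
     (\<forall>C\<in>\<C>. \<forall>a\<in>P. \<forall>a'\<in>P. \<forall>b\<in>- P. \<forall>b'\<in>- P. (a, b) \<in> C \<longrightarrow> (a', b') \<in> C)"

text \<open>When \<open>\<Omega>\<close> splits into the fibers \<open>P\<close> and \<open>- P\<close>, joined by a single class, orienting
  that class turns the span into a coherent algebra.\<close>

definition oriented_span :: "'a set \<Rightarrow> (real^'a^'a) set" where
  "oriented_span P = {M. \<forall>C\<in>\<C>. \<forall>a b a' b'. (a, b) \<in> C \<longrightarrow> (a', b') \<in> C \<longrightarrow>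
     (a \<in> P \<longleftrightarrow> a' \<in> P) \<longrightarrow> (b \<in> P \<longleftrightarrow> b' \<in> P) \<longrightarrow> M $ a $ b = M $ a' $ b'}"

lemma oriented_spanI:
  assumes "\<And>C a b a' b'. C \<in> \<C> \<Longrightarrow> (a, b) \<in> C \<Longrightarrow> (a', b') \<in> C \<Longrightarrow>
    (a \<in> P \<longleftrightarrow> a' \<in> P) \<Longrightarrow> (b \<in> P \<longleftrightarrow> b' \<in> P) \<Longrightarrow> M $ a $ b = M $ a' $ b'"
  shows "M \<in> oriented_span P"
  unfolding oriented_span_def mem_Collect_eq by (intro ballI allI impI) (rule assms)

lemma oriented_spanD:
  assumes "M \<in> oriented_span P" "C \<in> \<C>" "(a, b) \<in> C" "(a', b') \<in> C"
    "a \<in> P \<longleftrightarrow> a' \<in> P" "b \<in> P \<longleftrightarrow> b' \<in> P"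
  shows "M $ a $ b = M $ a' $ b'"
  by (rule assms(1)[unfolded oriented_span_def mem_Collect_eq, rule_format, OF assms(2-)])

lemma oriented_span_Compl: "oriented_span (- P) = oriented_span P"
  by (simp add: oriented_span_def)

text \<open>Classes are symmetric, so the joining class can be read in either direction. This lets
  sums over \<open>- P\<close> be treated like sums over \<open>P\<close>.\<close>

lemma two_fibers_Compl:
  assumes "two_fibers P"
  shows "two_fibers (- P)"
proof -
  have "(b', a') \<in> C" if "C \<in> \<C>" "a \<in> P" "a' \<in> P" "b \<in> - P" "b' \<in> - P" "(b, a) \<in> C" for C a a' b b'
  proof -
    have "(a, b) \<in> C"
      using class_sym that(1,6) .
    then have "(a', b') \<in> C"
      using assms that(1-5) unfolding two_fibers_def by blast
    then show ?thesis
      using class_sym that(1) by blast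
  qed
  then show ?thesis
    using assms unfolding two_fibers_def double_compl by blast
qed

text \<open>All of \<open>P \<times> - P\<close> lies in one class, whose two orientations are each
  a set of constancy for \<open>M\<close>.\<close>

lemma oriented_span_cross:
  assumes "two_fibers P" "M \<in> oriented_span P" "a \<in> P" "a' \<in> P" "b \<notin> P" "b' \<notin> P"
  shows "M $ a $ b = M $ a' $ b'" "M $ b $ a = M $ b' $ a'"
proof -
  obtain C where C: "C \<in> \<C>" "(a, b) \<in> C"
    using class_exists by blast
  have "(a', b') \<in> C"
    using assms C unfolding two_fibers_def by (meson ComplI)
  then show "M $ a $ b = M $ a' $ b'" "M $ b $ a = M $ b' $ a'"
    using assms C class_sym[OF C(1)] oriented_spanD[of M P C a b a' b'] oriented_spanD[of M P C b a b' a']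
    by simp_all
qed

text \<open>A pair lies inside \<open>P\<close> exactly when its endpoint count is two, and this
  count is constant on classes.\<close>

lemma block_iff:
  assumes "Id_on P \<in> \<C>" "C \<in> \<C>" "(a, b) \<in> C"
  shows "C \<in> block P \<longleftrightarrow> a \<in> P \<and> b \<in> P"
proof
  assume "a \<in> P \<and> b \<in> P"
  then have "c \<in> P \<and> d \<in> P" if "(c, d) \<in> C" for c d
    using fiber_count[OF assms that] by (cases "c \<in> P"; cases "d \<in> P") simp_all
  then show "C \<in> block P"
    using assms by (auto simp: block_def)
qed (use assms in \<open>auto simp: block_def\<close>)

section \<open>Closure of the oriented span under multiplication\<close>

definition restrict_block :: "'a set \<Rightarrow> real^'a^'a \<Rightarrow> real^'a^'a" where
  "restrict_block P M = (\<chi> a b. if a \<in> P \<and> b \<in> P then M $ a $ b else 0)"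

text \<open>Inside the block all endpoints lie in \<open>P\<close>, so the orientation conditions
  hold automatically and \<open>M\<close> is constant on each class of the block.\<close>

lemma restrict_block_mem:
  assumes P: "Id_on P \<in> \<C>" and M: "M \<in> oriented_span P"
  shows "restrict_block P M \<in> span (adjacency_matrix ` block P)"
proof (rule mem_span_classesI)
  show "block P \<subseteq> \<C>"
    by (auto simp: block_def)
  fix C a b
  show "restrict_block P M $ a $ b = restrict_block P M $ a' $ b'"
    if "C \<in> block P" "(a, b) \<in> C" "(a', b') \<in> C" for a' b'
  proof -
    have "a \<in> P" "b \<in> P" "a' \<in> P" "b' \<in> P" "C \<in> \<C>"
      using that by (auto simp: block_def)
    then show ?thesis
      using oriented_spanD[OF M _ that(2,3)] by (simp add: restrict_block_def)
  qed
  show "restrict_block P M $ a $ b = 0" if "C \<in> \<C> - block P" "(a, b) \<in> C"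
    using that block_iff[OF P, of C a b] by (auto simp: restrict_block_def)
qed

lemma block_span_subset: "span (adjacency_matrix ` block P) \<subseteq> S"
  unfolding configuration_span_def by (intro span_mono) (auto simp: block_def)

text \<open>This is the part of \<open>(M ** N) $ a $ b\<close> with middle point in
  \<open>P\<close>. With both endpoints in \<open>P\<close> it is an entry of a product of commuting
  block matrices, which lies in \<open>S\<close>. With one endpoint in \<open>P\<close> the crossing
  factor is constant and a row sum of a block remains; with none, both factors are constant.\<close>

lemma partial_product_const:
  assumes P: "two_fibers P" and M: "M \<in> oriented_span P" and N: "N \<in> oriented_span P"
    and C: "C \<in> \<C>" "(a, b) \<in> C" "(a', b') \<in> C" and orient: "a \<in> P \<longleftrightarrow> a' \<in> P" "b \<in> P \<longleftrightarrow> b' \<in> P"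
  shows "(\<Sum>c\<in>P. M $ a $ c * N $ c $ b) = (\<Sum>c\<in>P. M $ a' $ c * N $ c $ b')"
proof -
  have Id: "Id_on P \<in> \<C>" and card: "card {C \<in> \<C>. C \<subseteq> P \<times> P} \<le> 3"
    using P by (simp_all add: two_fibers_def block_def)
  let ?M = "restrict_block P M" and ?N = "restrict_block P N"
  have spans: "?M \<in> span (adjacency_matrix ` block P)" "?N \<in> span (adjacency_matrix ` block P)"
    using restrict_block_mem[OF Id] M N by blast+
  then have MN: "?M \<in> S" "?N \<in> S"
    using block_span_subset by blast+
  have row: "(\<Sum>c\<in>UNIV. restrict_block P X $ u $ c) = (\<Sum>c\<in>P. X $ u $ c)" if "u \<in> P" for X u
    using that by (intro sum.mono_neutral_cong_right) (auto simp: restrict_block_def)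
  consider "a \<in> P" "b \<in> P" | "a \<in> P" "b \<notin> P" | "a \<notin> P" "b \<in> P" | "a \<notin> P" "b \<notin> P"
    by blast
  then show ?thesis
  proof cases
    case 1
    have "u ** v = v ** u" if "u \<in> adjacency_matrix ` block P" "v \<in> adjacency_matrix ` block P" for u v
      using that block_commute[OF Id card] by (auto simp: block_def)
    then have "?M ** ?N = ?N ** ?M"
      using spans by (rule span_commute)
    then have "?M ** ?N \<in> S"
      using MN by (intro commuting_mult_S)
    then have "(?M ** ?N) $ a $ b = (?M ** ?N) $ a' $ b'"
      using C by (rule span_const)
    moreover have "(?M ** ?N) $ u $ v = (\<Sum>c\<in>P. M $ u $ c * N $ c $ v)" if "u \<in> P" "v \<in> P" for u v
      unfolding matrix_mult_nth using that
      by (intro sum.mono_neutral_cong_right) (auto simp: restrict_block_def)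
    ultimately show ?thesis
      using 1 orient by simp
  next
    case 2
    have const: "M $ u $ c * N $ c $ v = M $ u $ c * N $ a $ b" if "c \<in> P" "v \<notin> P" for u v c
      using oriented_span_cross(1)[OF P N that(1) 2(1) that(2) 2(2)] by simp
    have ab: "a' \<in> P" "b' \<notin> P"
      using 2 orient by simp_all
    have "(\<Sum>c\<in>P. M $ a $ c * N $ c $ b) = (\<Sum>c\<in>P. M $ a $ c) * N $ a $ b"
      unfolding sum_distrib_right by (intro sum.cong refl const 2)
    also have "(\<Sum>c\<in>P. M $ a $ c) = (\<Sum>c\<in>P. M $ a' $ c)"
      using row_sum_const[OF MN(1) Id Id_onI[OF 2(1)] Id_onI[OF ab(1)]] row[OF 2(1)] row[OF ab(1)] by simp
    also have "(\<Sum>c\<in>P. M $ a' $ c) * N $ a $ b = (\<Sum>c\<in>P. M $ a' $ c * N $ c $ b')"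
      unfolding sum_distrib_right by (intro sum.cong refl const[symmetric] ab)
    finally show ?thesis .
  next
    case 3
    \<comment> \<open>The restricted matrix is symmetric, so its column sums are row sums and
      \<open>row_sum_const\<close> applies.\<close>
    have col: "(\<Sum>c\<in>P. N $ c $ u) = (\<Sum>c\<in>UNIV. ?N $ u $ c)" if "u \<in> P" for u
    proof -
      have "(\<Sum>c\<in>UNIV. ?N $ c $ u) = (\<Sum>c\<in>P. N $ c $ u)"
        using that by (intro sum.mono_neutral_cong_right) (auto simp: restrict_block_def)
      moreover have "(\<Sum>c\<in>UNIV. ?N $ c $ u) = (\<Sum>c\<in>UNIV. ?N $ u $ c)"
        by (intro sum.cong refl S_sym MN)
      ultimately show ?thesis
        by simp
    qed
    have const: "M $ u $ c * N $ c $ v = M $ a $ b * N $ c $ v" if "c \<in> P" "u \<notin> P" for u v c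
      using oriented_span_cross(2)[OF P M that(1) 3(2) that(2) 3(1)] by simp
    have ab: "a' \<notin> P" "b' \<in> P"
      using 3 orient by simp_all
    have "(\<Sum>c\<in>P. M $ a $ c * N $ c $ b) = M $ a $ b * (\<Sum>c\<in>P. N $ c $ b)"
      unfolding sum_distrib_left by (intro sum.cong refl const 3)
    also have "(\<Sum>c\<in>P. N $ c $ b) = (\<Sum>c\<in>P. N $ c $ b')"
      using row_sum_const[OF MN(2) Id Id_onI[OF 3(2)] Id_onI[OF ab(2)]] col[OF 3(2)] col[OF ab(2)] by simp
    also have "M $ a $ b * (\<Sum>c\<in>P. N $ c $ b') = (\<Sum>c\<in>P. M $ a' $ c * N $ c $ b')"
      unfolding sum_distrib_left by (intro sum.cong refl const[symmetric] ab)
    finally show ?thesis .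
  next
    case 4
    then have ab: "a' \<notin> P" "b' \<notin> P"
      using orient by auto
    show ?thesis
    proof (rule sum.cong)
      fix c
      assume "c \<in> P"
      then show "M $ a $ c * N $ c $ b = M $ a' $ c * N $ c $ b'"
        using oriented_span_cross(2)[OF P M \<open>c \<in> P\<close> \<open>c \<in> P\<close> 4(1) ab(1)]
          oriented_span_cross(1)[OF P N \<open>c \<in> P\<close> \<open>c \<in> P\<close> 4(2) ab(2)] by simp
    qed simp
  qed
qed

lemma S_subset_oriented_span: "S \<subseteq> oriented_span P"
  using span_const by (intro subsetI oriented_spanI)

lemma coherent_oriented_span:
  assumes P: "two_fibers P"
  shows "coherent_algebra (oriented_span P)"
proof -
  have "subspace (oriented_span P)"
  proof (rule subspaceI)
    show "0 \<in> oriented_span P"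
      by (rule oriented_spanI) simp
    show "M + N \<in> oriented_span P" if MN: "M \<in> oriented_span P" "N \<in> oriented_span P" for M N
    proof (rule oriented_spanI)
      fix C a b a' b'
      assume *: "C \<in> \<C>" "(a, b) \<in> C" "(a', b') \<in> C" "(a \<in> P) = (a' \<in> P)" "(b \<in> P) = (b' \<in> P)"
      show "(M + N) $ a $ b = (M + N) $ a' $ b'"
        using oriented_spanD[OF MN(1) *] oriented_spanD[OF MN(2) *] by simp
    qed
    show "r *\<^sub>R M \<in> oriented_span P" if M: "M \<in> oriented_span P" for M r
    proof (rule oriented_spanI)
      fix C a b a' b'
      assume *: "C \<in> \<C>" "(a, b) \<in> C" "(a', b') \<in> C" "(a \<in> P) = (a' \<in> P)" "(b \<in> P) = (b' \<in> P)"
      show "(r *\<^sub>R M) $ a $ b = (r *\<^sub>R M) $ a' $ b'"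
        using oriented_spanD[OF M *] by simp
    qed
  qed
  moreover have "transpose M \<in> oriented_span P" if M: "M \<in> oriented_span P" for M
  proof (rule oriented_spanI)
    fix C a b a' b'
    assume "C \<in> \<C>" "(a, b) \<in> C" "(a', b') \<in> C" "(a \<in> P) = (a' \<in> P)" "(b \<in> P) = (b' \<in> P)"
    then show "transpose M $ a $ b = transpose M $ a' $ b'"
      using oriented_spanD[OF M, of C b a b' a'] class_sym[of C] by (simp add: transpose_def)
  qed
  moreover have "M ** N \<in> oriented_span P" if MN: "M \<in> oriented_span P" "N \<in> oriented_span P" for M N
  proof (rule oriented_spanI)
    \<comment> \<open>The half over \<open>- P\<close> is the half over \<open>P\<close> for the
      complementary fiber, which has the same oriented span.\<close>
    have split: "(M ** N) $ a $ b = (\<Sum>c\<in>P. M $ a $ c * N $ c $ b) + (\<Sum>c\<in>- P. M $ a $ c * N $ c $ b)"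
      for a b
      unfolding matrix_mult_nth using sum.union_disjoint[of P "- P"] by (simp add: Compl_partition)
    fix C a b a' b'
    assume C: "C \<in> \<C>" "(a, b) \<in> C" "(a', b') \<in> C" and orient: "(a \<in> P) = (a' \<in> P)" "(b \<in> P) = (b' \<in> P)"
    show "(M ** N) $ a $ b = (M ** N) $ a' $ b'"
      unfolding split
    proof (rule arg_cong2[where f = "(+)"])
      show "(\<Sum>c\<in>P. M $ a $ c * N $ c $ b) = (\<Sum>c\<in>P. M $ a' $ c * N $ c $ b')"
        by (rule partial_product_const[OF P MN C orient])
      show "(\<Sum>c\<in>- P. M $ a $ c * N $ c $ b) = (\<Sum>c\<in>- P. M $ a' $ c * N $ c $ b')"
        using orient
        by (intro partial_product_const[OF two_fibers_Compl[OF P] _ _ C])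
          (simp_all add: oriented_span_Compl MN)
    qed
  qed
  moreover have "(\<chi> a b. M $ a $ b * N $ a $ b) \<in> oriented_span P"
    if MN: "M \<in> oriented_span P" "N \<in> oriented_span P" for M N
  proof (rule oriented_spanI)
    fix C a b a' b'
    assume *: "C \<in> \<C>" "(a, b) \<in> C" "(a', b') \<in> C" "(a \<in> P) = (a' \<in> P)" "(b \<in> P) = (b' \<in> P)"
    show "(\<chi> a b. M $ a $ b * N $ a $ b) $ a $ b = (\<chi> a b. M $ a $ b * N $ a $ b) $ a' $ b'"
      using oriented_spanD[OF MN(1) *] oriented_spanD[OF MN(2) *] by simp
  qed
  moreover have "mat 1 \<in> oriented_span P" "all_ones \<in> oriented_span P"
    using one_mem all_ones_mem S_subset_oriented_span by blast+
  ultimately show ?thesis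
    unfolding coherent_algebra_def all_ones_def by blast
qed

text \<open>Two pairs of a class are equally or oppositely oriented, and a symmetric matrix does not
  distinguish the two orientations.\<close>

lemma symmetrization_oriented_span:
  assumes P: "two_fibers P"
  shows "S = symmetrization (oriented_span P)"
proof
  show "S \<subseteq> symmetrization (oriented_span P)"
    using S_subset_oriented_span transpose_S by (auto simp: symmetrization_def)
  show "symmetrization (oriented_span P) \<subseteq> S"
  proof
    fix M
    assume "M \<in> symmetrization (oriented_span P)"
    then have M: "M \<in> oriented_span P" and tr: "transpose M = M"
      by (auto simp: symmetrization_def)
    have sym: "M $ a $ b = M $ b $ a" for a b
      by (subst tr[symmetric]) (simp add: transpose_def)
    show "M \<in> S"
    proof (rule mem_spanI)
      fix C a b a' b'
      assume C: "C \<in> \<C>" "(a, b) \<in> C" "(a', b') \<in> C"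
      have "Id_on P \<in> \<C>"
        using P by (simp add: two_fibers_def)
      from fiber_count[OF this C] have "(a \<in> P \<longleftrightarrow> a' \<in> P) \<and> (b \<in> P \<longleftrightarrow> b' \<in> P) \<or>
          (a \<in> P \<longleftrightarrow> b' \<in> P) \<and> (b \<in> P \<longleftrightarrow> a' \<in> P)"
        by (cases "a \<in> P"; cases "b \<in> P"; cases "a' \<in> P"; cases "b' \<in> P") simp_all
      then show "M $ a $ b = M $ a' $ b'"
        using oriented_spanD[OF M C] oriented_spanD[OF M C(1,2) class_sym[OF C(1,3)]] sym[of a' b'] by auto
    qed
  qed
qed

lemma not_proper_two_fibers: "two_fibers P \<Longrightarrow> \<not> proper_configuration \<C>"
  using coherent_oriented_span symmetrization_oriented_span unfolding proper_configuration_def by blast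

section \<open>Fibers in rank at most five\<close>

lemma diagonal_class:
  obtains P where "a \<in> P" "Id_on P \<in> \<C>"
proof -
  obtain F where F: "F \<in> \<C>" "(a, a) \<in> F"
    using class_exists by blast
  \<comment> \<open>The identity matrix is constant on \<open>F\<close>, with value one at
    \<open>(a, a)\<close>.\<close>
  have "F \<subseteq> Id"
  proof
    fix p
    assume "p \<in> F"
    then have "(mat 1 :: real^'a^'a) $ a $ a = mat 1 $ fst p $ snd p"
      using span_const[OF one_mem F, of "fst p" "snd p"] by simp
    then show "p \<in> Id"
      by (cases p) (simp add: mat_def split: if_splits)
  qed
  then have "F = Id_on {b. (b, b) \<in> F}"
    by auto
  then show ?thesis
    using that[of "{b. (b, b) \<in> F}"] F by simp
qed

lemma diagonal_classes_disjoint: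
  assumes "Id_on P \<in> \<C>" "Id_on Q \<in> \<C>" "c \<in> P" "c \<in> Q"
  shows "P = Q"
proof -
  have "Id_on P = Id_on Q"
    using class_unique[OF assms(1,2), of "(c, c)"] assms(3,4) by blast
  then show ?thesis
    by (metis Domain_Id_on)
qed

text \<open>Three fibers need six classes, told apart by how many endpoints of their pairs lie in the
  first and in the second fiber.\<close>

lemma two_fibers_cover:
  assumes card: "card \<C> \<le> 5" and PQ: "Id_on P \<in> \<C>" "Id_on Q \<in> \<C>" and a: "a \<in> P" "b \<in> Q" "b \<notin> P"
  shows "Q = - P"
proof -
  have disj: "P \<inter> Q = {}"
    using diagonal_classes_disjoint[OF PQ] a by blast
  have "c \<in> Q" if "c \<notin> P" for c
  proof (rule ccontr)
    assume "c \<notin> Q"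
    \<comment> \<open>By \<open>fiber_count\<close> this signature is constant on classes, so it has
      at most as many values as there are classes. With \<open>a\<close> in \<open>P\<close>,
      \<open>b\<close> in \<open>Q\<close> and \<open>c\<close> in neither, six values
      occur.\<close>
    define sg :: "'a \<times> 'a \<Rightarrow> nat \<times> nat" where
      "sg = (\<lambda>(x, y). (of_bool (x \<in> P) + of_bool (y \<in> P), of_bool (x \<in> Q) + of_bool (y \<in> Q)))"
    have "sg p \<in> (\<lambda>C. sg (SOME q. q \<in> C)) ` \<C>" for p
    proof -
      obtain C where C: "C \<in> \<C>" "p \<in> C"
        using class_exists by blast
      then have "(SOME q. q \<in> C) \<in> C"
        by (meson someI)
      then have "sg p = sg (SOME q. q \<in> C)"
        using C fiber_count[OF PQ(1) C(1), of "fst p" "snd p" "fst (SOME q. q \<in> C)" "snd (SOME q. q \<in> C)"]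
          fiber_count[OF PQ(2) C(1), of "fst p" "snd p" "fst (SOME q. q \<in> C)" "snd (SOME q. q \<in> C)"]
        by (simp add: sg_def case_prod_unfold)
      then show ?thesis
        using C by blast
    qed
    then have "card (range sg) \<le> card \<C>"
      by (intro surj_card_le) auto
    have "a \<notin> Q"
      using a disj by blast
    then have "sg ` {(a, a), (b, b), (c, c), (a, b), (a, c), (b, c)} =
        {(2, 0), (0, 2), (0, 0), (1, 1), (1, 0), (0, 1)}"
      using a \<open>c \<notin> P\<close> \<open>c \<notin> Q\<close> by (simp add: sg_def numeral_2_eq_2)
    then have "{(2, 0), (0, 2), (0, 0), (1, 1), (1, 0), (0, 1)} \<subseteq> range sg"
      by (metis image_mono subset_UNIV)
    then have "card {(2, 0), (0, 2), (0, 0), (1, 1), (1, 0), (0, 1) :: nat \<times> nat} \<le> card (range sg)"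
      by (intro card_mono) (auto intro: finite_imageI)
    then show False
      using card \<open>card (range sg) \<le> card \<C>\<close> by simp
  qed
  then show ?thesis
    using disj by blast
qed

text \<open>All points of the fiber \<open>- P\<close> have the same valency in \<open>C\<close>,
  and it is positive at \<open>b\<close>. Since every pair of \<open>C\<close> has exactly one
  endpoint in \<open>P\<close>, the only possible neighbour of \<open>b'\<close> is
  \<open>p\<close>.\<close>

lemma singleton_fiber_cross:
  assumes P: "Id_on P \<in> \<C>" "Id_on (- P) \<in> \<C>" "P = {p}"
    and C: "C \<in> \<C>" "(p, b) \<in> C" and b: "b \<notin> P" "b' \<notin> P"
  shows "(p, b') \<in> C"
proof -
  have nbr: "c = p" if "(u, c) \<in> C" "u \<notin> P" for u c
    using fiber_count[OF P(1) C that(1)] P(3) b that(2) by (cases "c \<in> P") simp_all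
  have "1 = adjacency_matrix C $ b $ p"
    using class_sym[OF C] by simp
  also have "\<dots> \<le> (\<Sum>c\<in>UNIV. adjacency_matrix C $ b $ c)"
    by (intro member_le_sum) auto
  also have "\<dots> = (\<Sum>c\<in>UNIV. adjacency_matrix C $ b' $ c)"
    using row_sum_const[OF adjacency_mem[OF C(1)] P(2)] b by blast
  finally have "(\<Sum>c\<in>UNIV. adjacency_matrix C $ b' $ c) \<noteq> 0"
    by simp
  then obtain c where "adjacency_matrix C $ b' $ c \<noteq> 0"
    by (meson sum.not_neutral_contains_not_neutral)
  then have "(b', c) \<in> C"
    by (simp split: if_splits)
  then show ?thesis
    using nbr b class_sym C(1) by blast
qed

text \<open>Both blocks and the set of crossing classes are nonempty, which leaves at most
  \<open>5 - 1 - 1\<close> classes for a block. If both fibers have two points, each block has at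
  least two classes and only one crossing class is left; \<open>singleton_fiber_cross\<close> covers
  the other cases.\<close>

lemma two_fibersI:
  assumes card: "card \<C> \<le> 5" and P: "Id_on P \<in> \<C>" "Id_on (- P) \<in> \<C>"
    and ne: "P \<noteq> {}" "- P \<noteq> {}"
  shows "two_fibers P"
proof -
  let ?X = "\<C> - block P - block (- P)"
  have disj: "block P \<inter> block (- P) = {}"
    using class_nonempty by (force simp: block_def)
  have "block P \<subseteq> \<C>" "block (- P) \<subseteq> \<C>"
    by (auto simp: block_def)
  then have total: "card \<C> = card (block P) + card (block (- P)) + card ?X"
    using disj by (subst (1) card_Un_disjoint[symmetric]; (subst card_Un_disjoint[symmetric])?)
      (auto intro!: arg_cong[where f = card])
  have in_X: "C \<in> ?X" if "C \<in> \<C>" "(a, b) \<in> C" "a \<in> P" "b \<notin> P" for C a b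
    using that block_iff[OF P(1) that(1,2)] block_iff[OF P(2) that(1,2)] by simp
  have diag: "Id_on P \<in> block P" "Id_on (- P) \<in> block (- P)"
    using P by (auto simp: block_def)
  have pos: "card (block P) \<ge> 1" "card (block (- P)) \<ge> 1"
    using diag by (metis One_nat_def Suc_leI card_gt_0_iff empty_iff finite)+
  have pos': "card ?X \<ge> 1"
  proof -
    obtain a b where "a \<in> P" "b \<notin> P"
      using ne by auto
    moreover obtain C where "C \<in> \<C>" "(a, b) \<in> C"
      using class_exists by blast
    ultimately have "C \<in> ?X"
      using in_X by blast
    then show ?thesis
      by (metis One_nat_def Suc_leI card_gt_0_iff empty_iff finite)
  qed
  have two: "card (block R) \<ge> 2" if R: "Id_on R \<in> \<C>" "p \<in> R" "p' \<in> R" "p \<noteq> p'" for R p p'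
  proof -
    obtain C where C: "C \<in> \<C>" "(p, p') \<in> C"
      using class_exists by blast
    then have "C \<in> block R" "C \<noteq> Id_on R"
      using block_iff[OF R(1) C] R by auto
    moreover have "Id_on R \<in> block R"
      using R by (auto simp: block_def)
    ultimately have "card {C, Id_on R} \<le> card (block R)"
      by (intro card_mono) auto
    then show ?thesis
      using \<open>C \<noteq> Id_on R\<close> by simp
  qed
  have cross: "(a', b') \<in> C" if C: "C \<in> \<C>" "(a, b) \<in> C" and ab: "a \<in> P" "a' \<in> P" "b \<in> - P" "b' \<in> - P"
    for C a b a' b'
  proof -
    consider p where "P = {p}" | q where "- P = {q}"
      | p p' q q' where "p \<in> P" "p' \<in> P" "p \<noteq> p'" "q \<in> - P" "q' \<in> - P" "q \<noteq> q'"
      using ab by blast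
    then show ?thesis
    proof cases
      case 1
      then show ?thesis
        using singleton_fiber_cross[OF P 1 C(1), of b b'] C ab by auto
    next
      case 2
      have "b = q" "b' = q"
        using ab(3,4) unfolding 2 by simp_all
      have "Id_on (- (- P)) \<in> \<C>" "a \<notin> - P" "a' \<notin> - P"
        using P ab by simp_all
      from singleton_fiber_cross[OF P(2) this(1) 2 C(1) _ this(2,3)] have "(q, a') \<in> C"
        using class_sym[OF C] \<open>b = q\<close> by simp
      then show ?thesis
        using class_sym[OF C(1)] \<open>b' = q\<close> by simp
    next
      case 3
      have "card (block P) \<ge> 2" "card (block (- P)) \<ge> 2"
        using two[OF P(1) 3(1-3)] two[OF P(2) 3(4-6)] .
      then have "card ?X \<le> 1"
        using total card by linarith
      obtain D where D: "D \<in> \<C>" "(a', b') \<in> D"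
        using class_exists by blast
      have "C \<in> ?X" "D \<in> ?X"
        using in_X[OF C] in_X[OF D] ab by simp_all
      then have "C = D"
        using \<open>card ?X \<le> 1\<close> card_le_Suc0_iff_eq[of ?X] by simp
      then show ?thesis
        using D by simp
    qed
  qed
  show ?thesis
    unfolding two_fibers_def using P cross total card pos pos' by auto
qed

lemma not_proper_inhomogeneous:
  assumes "Id \<notin> \<C>" "card \<C> \<le> 5"
  shows "\<not> proper_configuration \<C>"
proof -
  \<comment> \<open>Start from the fiber of an arbitrary point; as \<open>Id\<close> is not a class,
    some point lies outside it.\<close>
  obtain P where P: "undefined \<in> P" "Id_on P \<in> \<C>"
    by (rule diagonal_class)
  have "Id_on UNIV = (Id :: 'a rel)"
    by auto
  then have "P \<noteq> UNIV"
    using P assms(1) by metis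
  then obtain b where b: "b \<notin> P"
    by blast
  obtain Q where Q: "b \<in> Q" "Id_on Q \<in> \<C>"
    by (rule diagonal_class)
  have "Q = - P"
    using two_fibers_cover[OF assms(2) P(2) Q(2) P(1) Q(1) b] .
  then have "two_fibers P"
    using two_fibersI[OF assms(2)] P Q by blast
  then show ?thesis
    by (rule not_proper_two_fibers)
qed

end

section \<open>Rank five\<close>

context symmetric_jordan_configuration
begin

text \<open>Properness makes the four-dimensional corner noncommutative, so it has a frame of the
  reals plus \<open>Sym2\<close>. The idempotent multiple \<open>u\<close> of
  \<open>all_ones\<close> is orthogonal to the corner and supplies the other copy of the
  reals.\<close>

lemma isomorphic_rank_5:
  assumes Id: "Id \<in> \<C>" and card: "card \<C> = 5" and proper: "proper_configuration \<C>"
  shows "jordan_algebra_isomorphic S jordan_product RR_Sym2 RR_Sym2_product"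
proof -
  define n where "n = real CARD('a)"
  have "n > 0"
    by (simp add: n_def)
  obtain A where A: "A \<in> corner" "\<And>t b. A ** A \<noteq> t *\<^sub>R A + b *\<^sub>R corner_unit"
    using exists_nonquadratic[OF Id] card by auto
  have dim: "dim corner \<le> 4"
    using dim_corner[OF Id] card by simp
  obtain X Y where XY: "X \<in> corner" "Y \<in> corner" "X ** Y \<noteq> Y ** X"
    using not_proper_if_corner_commutative[OF Id] proper by blast
  obtain e1 e2 e3 w where mem: "e1 \<in> corner" "e2 \<in> corner" "e3 \<in> corner" "w \<in> corner"
    and nz: "e1 \<noteq> 0" "e2 \<noteq> 0" "e3 \<noteq> 0" "w \<noteq> 0"
    and e: "e1 ** e1 = e1" "e2 ** e2 = e2" "e3 ** e3 = e3" "e1 ** e2 = 0" "e1 ** e3 = 0" "e2 ** e3 = 0"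
    and w: "e1 ** w = w ** e2" "e2 ** w = w ** e1" "e3 ** w = 0" "w ** e3 = 0"
      "w ** e1 + w ** e2 = w" "w ** w = e1 + e2"
    and span: "corner \<subseteq> span {w, e1, e2, e3}"
    using corner.commute_or_Sym2_frame[OF A dim XY] .
  have rev: "e2 ** e1 = 0" "e3 ** e1 = 0" "e3 ** e2 = 0"
    using e(4-6) corner.symmetric[OF mem(1)] corner.symmetric[OF mem(2)] corner.symmetric[OF mem(3)]
    by (metis matrix_transpose_mul mat_0 transpose_mat)+
  define u :: "real^'a^'a" where "u = (1 / n) *\<^sub>R all_ones"
  have ones: "all_ones = n *\<^sub>R u"
    using \<open>n > 0\<close> by (simp add: u_def)
  have "all_ones \<in> span {u, w, e1, e2, e3}"
    unfolding ones by (intro span_scale span_base) simp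
  moreover have "corner \<subseteq> span {u, w, e1, e2, e3}"
    using span span_mono[of "{w, e1, e2, e3}" "{u, w, e1, e2, e3}"] by blast
  ultimately have "S \<subseteq> span {u, w, e1, e2, e3}"
    unfolding S_eq_span_corner[OF Id] by (intro span_minimal) auto
  moreover have "u \<in> S"
    using subspace_S all_ones_mem by (simp add: u_def subspace_scale)
  then have "span {u, w, e1, e2, e3} \<subseteq> S"
    using mem cornerD(1) subspace_S by (intro span_minimal) auto
  ultimately have S: "S = span {u, w, e1, e2, e3}"
    by blast
  have "u \<noteq> 0"
    using \<open>n > 0\<close> by (simp add: u_def vec_eq_iff)
  have "u ** u = u"
    using \<open>n > 0\<close> by (simp add: u_def matrix_mult_bilinear all_ones_square n_def)
  have "u ** X = 0" "X ** u = 0" if "X \<in> corner" for X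
    using corner_left[OF that] cornerD(2)[OF that] by (simp_all add: u_def matrix_mult_bilinear)
  note u = \<open>u ** u = u\<close> this(1)[OF mem(4)] this(1)[OF mem(1)] this(1)[OF mem(2)] this(1)[OF mem(3)]
    this(2)[OF mem(4)] this(2)[OF mem(1)] this(2)[OF mem(2)] this(2)[OF mem(3)]
  show ?thesis
    using Sym2_frame_isomorphic[OF S jordan_S \<open>u \<noteq> 0\<close> nz(4,1-3) u e rev w] .
qed

end

theorem theorem3p1:
  fixes \<C> :: "('a::finite) rel set"
  assumes "jordan_configuration \<C>"
    and "symmetric_configuration \<C>"
    and "proper_configuration \<C>"
  shows "card \<C> \<ge> 5 \<and>
    (card \<C> = 5 \<longrightarrow>
       homogeneous_configuration \<C> \<and>
       jordan_algebra_isomorphic (configuration_span \<C>) jordan_product RR_Sym2 RR_Sym2_product)"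
proof -
  interpret symmetric_jordan_configuration \<C>
    using assms(1,2) by unfold_locales
  have Id: "Id \<in> \<C>" if "card \<C> \<le> 5"
    using not_proper_inhomogeneous that assms(3) by blast
  have "card \<C> \<ge> 5"
  proof (rule ccontr)
    assume "\<not> card \<C> \<ge> 5"
    then have "Id \<in> \<C>" "card \<C> \<le> 3 \<or> card \<C> = 4"
      using Id by auto
    then show False
      using not_proper_rank_le_3 not_proper_rank_4 assms(3) by blast
  qed
  then show ?thesis
    using Id isomorphic_rank_5 assms(3) by (simp add: homogeneous_configuration_def)
qed

end
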